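(* The map $\Psi:a\mapsto\mu_a$ is discontinuous (with respect to the weak* topology on measures) at every parameter $a\in(0,2]$ for which $f_a$ is a post-critically finite Misiurewicz map in the quadratic family.
   Context: The quadratic family is $f_a(x)=1-ax^2$, $0<a\le 2$, acting on $I=[-1,1]$; its critical point is $0$. $f_a$ is a post-critically finite Misiurewicz map if its critical orbit is pre-periodic to an unstable periodic orbit, i.e. $f_a^N(0)$ belongs, for some $N\ge1$, to a periodic orbit $\{x_1,\dots,x_p\}$ of period $p$ with $|Df_a^p(x_1)|>1$. An acip of $f_a$ is an absolutely continuous (with respect to Lebesgue measure) invariant probability measure. If $f_a$ admits an acip, $\mu_a$ denotes that acip; if $f_a$ has a periodic attractor $\{x_1,\dots,x_p\}$, then $\mu_a=\frac1p\sum_{i=1}^p\delta_{x_i}$. In either case $\mu_a$ is the natural measure of $f_a$, i.e. it describes the asymptotic distribution of the orbits of Lebesgue almost all $x\in I$. By a theorem of Lyubich, for Lebesgue almost all $a\in(0,2]$ the map $f_a$ either has a periodic attractor or admits an acip, so $\Psi:a\mapsto\mu_a$, the natural measure of $f_a$, is defined for almost all $a\in(0,2]$; Misiurewicz maps in the quadratic family are known to admit an acip, so $\Psi$ is defined at them. *)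

theory Defs
  imports "HOL-Probability.Probability"
begin

definition quad :: "real \<Rightarrow> real \<Rightarrow> real" where
  "quad a x = 1 - a * x\<^sup>2"

abbreviation ivl_I :: "real set" where
  "ivl_I \<equiv> {-1..1}"

definition periodic_point :: "real \<Rightarrow> nat \<Rightarrow> real \<Rightarrow> bool" where
  "periodic_point a p x \<longleftrightarrow> x \<in> ivl_I \<and> 0 < p \<and> (quad a ^^ p) x = x \<and>
     (\<forall>k. 0 < k \<and> k < p \<longrightarrow> (quad a ^^ k) x \<noteq> x)"

definition periodic_orbit :: "real \<Rightarrow> nat \<Rightarrow> real \<Rightarrow> real set" where
  "periodic_orbit a p x = (\<lambda>k. (quad a ^^ k) x) ` {..<p}"

definition unstable_periodic_orbit :: "real \<Rightarrow> real set \<Rightarrow> bool" where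
  "unstable_periodic_orbit a C \<longleftrightarrow>
     (\<exists>p x. periodic_point a p x \<and> C = periodic_orbit a p x \<and> \<bar>deriv (quad a ^^ p) x\<bar> > 1)"

definition periodic_attractor :: "real \<Rightarrow> real set \<Rightarrow> bool" where
  "periodic_attractor a C \<longleftrightarrow>
     (\<exists>p x. periodic_point a p x \<and> C = periodic_orbit a p x \<and> \<bar>deriv (quad a ^^ p) x\<bar> < 1)"

definition pcf_misiurewicz :: "real \<Rightarrow> bool" where
  "pcf_misiurewicz a \<longleftrightarrow> (\<exists>N\<ge>1. \<exists>C. unstable_periodic_orbit a C \<and> (quad a ^^ N) 0 \<in> C)"

definition acip :: "real \<Rightarrow> real measure \<Rightarrow> bool" where
  "acip a \<mu> \<longleftrightarrow> sets \<mu> = sets (restrict_space borel ivl_I) \<and> prob_space \<mu> \<and>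
     absolutely_continuous (restrict_space lborel ivl_I) \<mu> \<and> distr \<mu> \<mu> (quad a) = \<mu>"

text \<open>The measure \<open>1/p \<cdot> (\<delta>(x\<^sub>1) + \<dots> + \<delta>(x\<^sub>p))\<close> for \<open>C = {x\<^sub>1, \<dots>, x\<^sub>p}\<close>, as a Borel measure on \<open>ivl_I\<close>.\<close>

definition orbit_measure :: "real set \<Rightarrow> real measure" where
  "orbit_measure C = distr (uniform_count_measure C) (restrict_space borel ivl_I) (\<lambda>x. x)"

definition natural_params :: "real set" where
  "natural_params = {a \<in> {0<..2}. (\<exists>C. periodic_attractor a C) \<or> (\<exists>\<mu>. acip a \<mu>)}"

text \<open>For \<open>a \<in> {0<..2}\<close> a periodic attractor is unique, an acip is unique, and the two do not
  coexist, so neither the choice operator nor the order of the cases matters.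
  The last branch is a default value outside \<open>natural_params\<close>.\<close>

definition natural_measure :: "real \<Rightarrow> real measure" where
  "natural_measure a =
     (if \<exists>C. periodic_attractor a C then orbit_measure (SOME C. periodic_attractor a C)
      else if \<exists>\<mu>. acip a \<mu> then (SOME \<mu>. acip a \<mu>)
      else null_measure (restrict_space borel ivl_I))"

text \<open>The weak* topology on the finite Borel measures on \<open>ivl_I\<close>: the coarsest one making
  \<open>\<mu> \<mapsto> \<integral>\<phi> d\<mu>\<close> continuous for every continuous \<open>\<phi>\<close> on \<open>ivl_I\<close>.\<close>

definition weak_star :: "real measure topology" where
  "weak_star = topology_generated_by
     {{\<mu>. sets \<mu> = sets (restrict_space borel ivl_I) \<and> finite_measure \<mu> \<and> (\<integral>x. \<phi> x \<partial>\<mu>) \<in> U} | \<phi> U.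
       continuous_on ivl_I (\<phi> :: real \<Rightarrow> real) \<and> open U}"

end

theory Submission
  imports Defs
begin

text \<open>Let \<open>x\<close> be the point where the critical orbit of \<open>quad a\<close> lands on the repelling orbit \<open>C\<close>.
  The relation between \<open>x\<close> and the critical point is not persistent in the parameter (it is a
  nontrivial polynomial equation in \<open>a\<close>), so for parameters \<open>b < a\<close> close to \<open>a\<close> the critical orbit
  stays near \<open>C\<close> for a long time and then leaves a fixed neighbourhood of \<open>x\<close>. Preimages of the
  critical point accumulate at \<open>x\<close> from each side that meets \<open>ivl_I\<close>, so the intermediate value theorem in the
  parameter yields \<open>b\<close> for which the critical point is periodic but spends most of its period near
  \<open>C\<close>. By Singer's theorem the superstable orbit is the only attractor of \<open>quad b\<close>, so the natural
  measure of \<open>quad b\<close> has most of its mass near \<open>C\<close>. On the other hand, \<open>quad a\<close> has no attractor, hence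
  its natural measure gives no mass to the finite set \<open>C\<close>. (If \<open>quad a\<close> had no acip, this would be
  the null measure, so the existence of the acip plays no role.)\<close>

subsection \<open>Iterates and secant slopes\<close>

text \<open>The slope of the secant of the \<open>n\<close>-th iterate; on the diagonal it is the derivative.\<close>

definition quad_secant :: "real \<Rightarrow> nat \<Rightarrow> real \<Rightarrow> real \<Rightarrow> real" where
  "quad_secant a n y z = (\<Prod>i<n. - a * ((quad a ^^ i) y + (quad a ^^ i) z))"

text \<open>This makes every iterate monotone on the segment from \<open>x\<close> to
  \<open>y\<close>. The inequality is weak so that the condition is closed and passes to the end of
  a maximal segment.\<close>

definition same_side :: "real \<Rightarrow> real \<Rightarrow> real \<Rightarrow> bool" where
  "same_side a x y \<longleftrightarrow> (\<forall>i. (quad a ^^ i) x * (quad a ^^ i) y \<ge> 0)"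

lemma quad_pow_add: "(quad a ^^ (m + n)) x = (quad a ^^ m) ((quad a ^^ n) x)"
  by (simp add: funpow_add)

lemma quad_pow_Suc: "(quad a ^^ Suc n) x = 1 - a * ((quad a ^^ n) x)\<^sup>2"
  by (simp add: quad_def[of a "(quad a ^^ n) x"])

lemma quad_pow_mult_fixed:
  assumes "(quad a ^^ q) x = x"
  shows "(quad a ^^ (q * n)) x = x"
  using assms by (induction n) (simp_all add: quad_pow_add)

lemma quad_pow_in_ivl:
  assumes "0 < a" "a \<le> 2" "x \<in> ivl_I"
  shows "(quad a ^^ n) x \<in> ivl_I"
proof (induction n)
  case (Suc n)
  have "\<bar>(quad a ^^ n) x\<bar> \<le> 1" using Suc by auto
  then have "((quad a ^^ n) x)\<^sup>2 \<le> 1" by (simp add: abs_square_le_1)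
  moreover from this have "a * ((quad a ^^ n) x)\<^sup>2 \<le> 2 * 1"
    using assms by (intro mult_mono) auto
  ultimately show ?case using assms by (simp add: quad_pow_Suc del: funpow.simps)
qed (use assms in simp)

lemma tendsto_quad_pow [tendsto_intros]:
  assumes "(A \<longlongrightarrow> a) F" "(Y \<longlongrightarrow> y) F"
  shows "((\<lambda>t. (quad (A t) ^^ n) (Y t)) \<longlongrightarrow> (quad a ^^ n) y) F"
proof (induction n)
  case (Suc n)
  then show ?case unfolding quad_pow_Suc using assms(1) by (intro tendsto_intros)
qed (use assms in simp)

lemma tendsto_quad_secant [tendsto_intros]:
  assumes "(A \<longlongrightarrow> a) F" "(Y \<longlongrightarrow> y) F" "(Z \<longlongrightarrow> z) F"
  shows "((\<lambda>t. quad_secant (A t) n (Y t) (Z t)) \<longlongrightarrow> quad_secant a n y z) F"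
  unfolding quad_secant_def using assms by (intro tendsto_intros)

lemma continuous_on_quad_pow [continuous_intros]:
  "continuous_on S A \<Longrightarrow> continuous_on S Y \<Longrightarrow> continuous_on S (\<lambda>t. (quad (A t) ^^ n) (Y t))"
  unfolding continuous_on_def by (auto intro: tendsto_intros)

lemma continuous_on_quad_secant [continuous_intros]:
  "continuous_on S A \<Longrightarrow> continuous_on S Y \<Longrightarrow> continuous_on S Z \<Longrightarrow>
    continuous_on S (\<lambda>t. quad_secant (A t) n (Y t) (Z t))"
  unfolding continuous_on_def by (auto intro: tendsto_intros)

lemma quad_pow_diff: "(quad a ^^ n) y - (quad a ^^ n) z = quad_secant a n y z * (y - z)"
proof (induction n)
  case (Suc n)
  have "(quad a ^^ Suc n) y - (quad a ^^ Suc n) z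
      = - a * ((quad a ^^ n) y + (quad a ^^ n) z) * ((quad a ^^ n) y - (quad a ^^ n) z)"
    by (simp add: quad_pow_Suc algebra_simps power2_eq_square del: funpow.simps)
  then show ?case using Suc by (simp add: quad_secant_def algebra_simps)
qed (simp add: quad_secant_def)

lemma quad_secant_add:
  "quad_secant a (m + n) y z
    = quad_secant a m y z * quad_secant a n ((quad a ^^ m) y) ((quad a ^^ m) z)"
proof (induction n)
  case (Suc n)
  then show ?case
    by (simp add: quad_secant_def quad_pow_add[of n m for n m, symmetric] add.commute)
qed (simp add: quad_secant_def)

lemma quad_secant_mult_fixed:
  assumes "(quad a ^^ q) x = x"
  shows "quad_secant a (q * n) x x = quad_secant a q x x ^ n"
proof (induction n)
  case (Suc n)
  then show ?case using assms by (simp add: quad_secant_add)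
qed (simp add: quad_secant_def)

lemma DERIV_quad_pow: "((quad a ^^ n) has_real_derivative quad_secant a n x x) (at x)"
proof (induction n)
  case (Suc n)
  have "((\<lambda>y. 1 - a * ((quad a ^^ n) y)\<^sup>2) has_real_derivative quad_secant a (Suc n) x x) (at x)"
    by (auto intro!: derivative_eq_intros Suc simp: quad_secant_def)
  then show ?case unfolding quad_pow_Suc[symmetric] .
next
  case 0
  show ?case by (simp add: quad_secant_def id_def)
qed

lemma deriv_quad_pow: "deriv (quad a ^^ n) x = quad_secant a n x x"
  by (intro DERIV_imp_deriv DERIV_quad_pow)

text \<open>The derivative of one full turn has each orbit point as a factor, so a nonzero
  multiplier keeps the cycle away from the critical point.\<close>

lemma quad_pow_nonzero:
  assumes "(quad a ^^ q) x = x" "0 < q" "quad_secant a q x x \<noteq> 0"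
  shows "(quad a ^^ i) x \<noteq> 0"
proof -
  have "(quad a ^^ (i mod q)) x \<noteq> 0"
    using assms(2,3) by (auto simp: quad_secant_def)
  moreover have "(quad a ^^ i) x = (quad a ^^ (i mod q + q * (i div q))) x" by simp
  ultimately show ?thesis
    by (metis quad_pow_add quad_pow_mult_fixed[OF assms(1)])
qed

text \<open>The chain rule for \<open>i + q\<close> can be split in two ways; the derivative of the
  \<open>i\<close>-th iterate cancels because the orbit avoids 0.\<close>

lemma quad_secant_orbit:
  assumes "(quad a ^^ q) x = x" "0 < q" "quad_secant a q x x \<noteq> 0"
  shows "quad_secant a q ((quad a ^^ i) x) ((quad a ^^ i) x) = quad_secant a q x x"
proof -
  have "quad_secant a i x x \<noteq> 0"
    using quad_pow_nonzero[OF assms] assms(2,3) by (auto simp: quad_secant_def)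
  moreover have "quad_secant a (i + q) x x
      = quad_secant a i x x * quad_secant a q ((quad a ^^ i) x) ((quad a ^^ i) x)"
    by (rule quad_secant_add)
  moreover have "quad_secant a (i + q) x x = quad_secant a i x x * quad_secant a q x x"
    unfolding add.commute[of i q] quad_secant_add assms(1) by (rule mult.commute)
  ultimately show ?thesis by simp
qed

subsection \<open>Singer's theorem\<close>

lemma same_side_cong:
  assumes "\<And>i. (quad a ^^ i) x \<noteq> 0" "same_side a x u" "same_side a x v"
  shows "same_side a u v"
  unfolding same_side_def
proof
  fix i
  show "0 \<le> (quad a ^^ i) u * (quad a ^^ i) v"
    using assms unfolding same_side_def
    by (smt (verit) mult_neg_pos mult_nonneg_nonneg mult_nonpos_nonpos mult_pos_neg)
qed

text \<open>Sums of two numbers on the same side of 0 have a common sign, so corresponding factors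
  of the slopes never have opposite signs.\<close>

lemma quad_secant_same_side:
  assumes "same_side a x y"
  shows "0 \<le> quad_secant a n x x * quad_secant a n y x"
    and "0 \<le> quad_secant a n x x * quad_secant a n y y"
proof -
  have *: "0 \<le> (- a * (u + u)) * (- a * (v + u))" "0 \<le> (- a * (u + u)) * (- a * (v + v))"
    if "0 \<le> u * v" for u v :: real
  proof -
    have "(- a * (u + u)) * (- a * (v + u)) = 2 * a\<^sup>2 * (u * v + u * u)"
      "(- a * (u + u)) * (- a * (v + v)) = 4 * a\<^sup>2 * (u * v)"
      by (simp_all add: algebra_simps power2_eq_square)
    then show "0 \<le> (- a * (u + u)) * (- a * (v + u))" "0 \<le> (- a * (u + u)) * (- a * (v + v))"
      using that by (simp_all only: mult_nonneg_nonneg add_nonneg_nonneg zero_le_square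
        zero_le_power2 zero_le_numeral)
  qed
  show "0 \<le> quad_secant a n x x * quad_secant a n y x"
    "0 \<le> quad_secant a n x x * quad_secant a n y y"
    using assms unfolding same_side_def quad_secant_def prod.distrib[symmetric]
    by (blast intro: prod_nonneg *)+
qed

text \<open>The factorwise inequality \<open>(u + v)\<^sup>2 \<ge> 4uv\<close> says that the maps \<open>quad a\<close> expand cross ratios;
  this replaces the negative Schwarzian derivative in Singer's theorem.\<close>

lemma multiplier_product_less_one:
  assumes "a \<noteq> 0" "0 < q" "u \<noteq> v" "(quad a ^^ q) u = u" "(quad a ^^ q) v = v" "same_side a u v"
  shows "quad_secant a q u u * quad_secant a q v v < 1"
proof -
  obtain m where m: "q = Suc m" using assms(2) gr0_implies_Suc by blast
  define U where "U i = (quad a ^^ i) u" for i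
  define V where "V i = (quad a ^^ i) v" for i
  \<comment> \<open>The factor at time 0 is split off: there \<open>u \<noteq> v\<close> makes the
    inequality strict, and \<open>R > 0\<close> carries the strictness over to the whole product.
    For the later factors the weak inequality suffices.\<close>
  define R where "R = (\<Prod>i<m. a\<^sup>2 * (U (Suc i) + V (Suc i))\<^sup>2)"
  define R' where "R' = (\<Prod>i<m. a\<^sup>2 * (4 * (U (Suc i) * V (Suc i))))"
  have UV: "0 \<le> U i * V i" for i using assms(6) by (simp add: same_side_def U_def V_def)
  have amgm: "4 * (s * t) \<le> (s + t)\<^sup>2" for s t :: real
    using zero_le_power2[of "s - t"] by (simp add: power2_eq_square algebra_simps)
  have "quad_secant a q u v = 1"
    using quad_pow_diff[of q a u v] assms(3-5) by simp
  then have "1 = (\<Prod>i<q. - a * (U i + V i)) * (\<Prod>i<q. - a * (U i + V i))"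
    by (simp add: quad_secant_def U_def V_def)
  also have "\<dots> = (\<Prod>i<q. a\<^sup>2 * (U i + V i)\<^sup>2)"
    unfolding prod.distrib[symmetric]
    by (intro prod.cong) (simp_all add: power2_eq_square algebra_simps)
  also have "\<dots> = a\<^sup>2 * (U 0 + V 0)\<^sup>2 * R"
    unfolding m R_def by (simp add: prod.lessThan_Suc_shift del: prod.lessThan_Suc)
  finally have 1: "1 = a\<^sup>2 * (U 0 + V 0)\<^sup>2 * R" .
  have "0 \<le> R" unfolding R_def by (intro prod_nonneg) auto
  then have "0 < R" using 1 by (cases "R = 0") auto
  have R': "R' \<le> R"
    unfolding R_def R'_def using UV amgm
    by (intro prod_mono conjI mult_left_mono) auto
  have "quad_secant a q u u * quad_secant a q v v = (\<Prod>i<q. a\<^sup>2 * (4 * (U i * V i)))"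
    unfolding quad_secant_def prod.distrib[symmetric]
    by (intro prod.cong) (simp_all add: power2_eq_square algebra_simps U_def V_def)
  also have "\<dots> = a\<^sup>2 * (4 * (U 0 * V 0)) * R'"
    unfolding m R'_def by (simp add: prod.lessThan_Suc_shift del: prod.lessThan_Suc)
  also have "\<dots> \<le> a\<^sup>2 * (4 * (U 0 * V 0)) * R"
    using R' UV[of 0] by (intro mult_left_mono) auto
  also have "\<dots> < a\<^sup>2 * (U 0 + V 0)\<^sup>2 * R"
  proof -
    have "(U 0 + V 0)\<^sup>2 - 4 * (U 0 * V 0) = (u - v)\<^sup>2"
      by (simp add: U_def V_def power2_eq_square algebra_simps)
    moreover have "(u - v)\<^sup>2 > 0" using assms(3) by simp
    ultimately have "4 * (U 0 * V 0) < (U 0 + V 0)\<^sup>2" by linarith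
    then show ?thesis using \<open>0 < R\<close> assms(1)
      by (intro mult_strict_right_mono mult_strict_left_mono) auto
  qed
  finally show ?thesis using 1 by simp
qed

section \<open>Immediate basins of attraction\<close>

lemma local_attraction:
  assumes "(quad a ^^ q) x = x" "\<bar>quad_secant a q x x\<bar> < 1"
  obtains r where "0 < r" "\<And>y. \<bar>y - x\<bar> < r \<Longrightarrow> (\<lambda>n. (quad a ^^ (q * n)) y) \<longlonglongrightarrow> x"
proof -
  define \<kappa> where "\<kappa> = (\<bar>quad_secant a q x x\<bar> + 1) / 2"
  have \<kappa>: "\<bar>quad_secant a q x x\<bar> < \<kappa>" "0 \<le> \<kappa>" "\<kappa> < 1" using assms(2) by (auto simp: \<kappa>_def)
  have "((\<lambda>y. \<bar>quad_secant a q y x\<bar>) \<longlongrightarrow> \<bar>quad_secant a q x x\<bar>) (nhds x)"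
    by (intro tendsto_intros)
      (auto simp: filterlim_def)
  then have "\<forall>\<^sub>F y in nhds x. \<bar>quad_secant a q y x\<bar> < \<kappa>"
    using \<kappa>(1) by (rule order_tendstoD)
  then obtain r where r: "0 < r" "\<And>y. \<bar>y - x\<bar> < r \<Longrightarrow> \<bar>quad_secant a q y x\<bar> < \<kappa>"
    unfolding eventually_nhds_metric dist_real_def by blast
  have "(\<lambda>n. (quad a ^^ (q * n)) y) \<longlonglongrightarrow> x" if y: "\<bar>y - x\<bar> < r" for y
  proof -
    have bound: "\<bar>(quad a ^^ (q * n)) y - x\<bar> \<le> \<kappa> ^ n * \<bar>y - x\<bar>" for n
    proof (induction n)
      case (Suc n)
      let ?w = "(quad a ^^ (q * n)) y"
      have "\<kappa> ^ n * \<bar>y - x\<bar> \<le> 1 * \<bar>y - x\<bar>"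
        using \<kappa> by (intro mult_right_mono power_le_one) auto
      then have "\<bar>?w - x\<bar> \<le> \<bar>y - x\<bar>" using Suc by simp
      then have "\<bar>?w - x\<bar> < r" using y by (rule le_less_trans)
      then have s: "\<bar>quad_secant a q ?w x\<bar> \<le> \<kappa>" using r(2) less_imp_le by blast
      have "\<bar>(quad a ^^ (q * Suc n)) y - x\<bar> = \<bar>quad_secant a q ?w x\<bar> * \<bar>?w - x\<bar>"
        using quad_pow_diff[of q a ?w x] assms(1) by (simp add: quad_pow_add abs_mult)
      also have "\<dots> \<le> \<kappa> * (\<kappa> ^ n * \<bar>y - x\<bar>)"
        using s Suc \<kappa> by (intro mult_mono) auto
      finally show ?case by (simp add: mult.assoc)
    qed simp
    have "(\<lambda>n. \<kappa> ^ n * \<bar>y - x\<bar>) \<longlonglongrightarrow> 0 * \<bar>y - x\<bar>"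
      using \<kappa> by (intro tendsto_mult LIMSEQ_power_zero tendsto_const) auto
    then have "(\<lambda>n. \<kappa> ^ n * \<bar>y - x\<bar>) \<longlonglongrightarrow> 0" by simp
    then have "(\<lambda>n. (quad a ^^ (q * n)) y - x) \<longlonglongrightarrow> 0"
      by (rule Lim_null_comparison[rotated]) (simp add: bound)
    then show ?thesis by (simp add: LIM_zero_iff)
  qed
  with r(1) that show ?thesis by blast
qed

lemma IVT_between:
  fixes h :: "real \<Rightarrow> real"
  assumes "continuous_on {l..u} h" "s \<in> {l..u}" "t \<in> {l..u}" "h s \<le> c" "c \<le> h t"
  obtains w where "w \<in> {l..u}" "h w = c"
proof -
  have "connected (h ` {l..u})" using assms(1) by (intro connected_continuous_image) auto
  then have "{h s..h t} \<subseteq> h ` {l..u}" using assms(2,3) by (intro connected_contains_Icc) auto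
  then show ?thesis using assms(4,5) that by (auto simp: image_iff subset_iff)
qed

text \<open>Bounds the basins, which are taken in the whole line. If \<open>w\<close> is the current
  modulus, then \<open>a * w \<ge> 3\<close>, so the next modulus is at least
  \<open>3 * w - 1\<close>, which is at least \<open>w\<close> because
  \<open>w \<ge> 1\<close>.\<close>

lemma quad_pow_escape:
  assumes "0 < a" "3 / a \<le> \<bar>y\<bar>" "1 \<le> \<bar>y\<bar>"
  shows "\<bar>y\<bar> \<le> \<bar>(quad a ^^ n) y\<bar>"
proof (induction n)
  case (Suc n)
  let ?w = "\<bar>(quad a ^^ n) y\<bar>"
  have "3 / a \<le> ?w" using Suc assms(2) by (rule order_trans[rotated])
  then have "3 \<le> a * ?w" using assms(1) by (simp add: field_simps)
  then have "3 * ?w \<le> (a * ?w) * ?w" by (rule mult_right_mono) simp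
  also have "\<dots> = a * ((quad a ^^ n) y)\<^sup>2" by (simp add: power2_eq_square)
  finally have "3 * ?w \<le> 1 - (quad a ^^ Suc n) y" by (simp only: quad_pow_Suc)
  then show ?case using Suc assms(3) by linarith
qed simp

text \<open>If an orbit in the basin hit 0, the critical orbit would converge to \<open>x\<close>
  along a progression of step \<open>q\<close>.\<close>

lemma basin_avoids_zero:
  assumes "0 < q" "\<And>j. \<not> (\<lambda>n. (quad a ^^ (j + q * n)) 0) \<longlonglongrightarrow> x"
    and "(\<lambda>n. (quad a ^^ (q * n)) w) \<longlonglongrightarrow> x"
  shows "(quad a ^^ i) w \<noteq> 0"
proof
  assume 0: "(quad a ^^ i) w = 0"
  have "(quad a ^^ (q * (n + i))) w = (quad a ^^ ((q * i - i) + q * n)) 0" for n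
  proof -
    have "i \<le> q * i" using assms(1) by simp
    then have "q * (n + i) = ((q * i - i) + q * n) + i" unfolding distrib_left by linarith
    then show ?thesis by (simp only: quad_pow_add 0)
  qed
  moreover have "(\<lambda>n. (quad a ^^ (q * (n + i))) w) \<longlonglongrightarrow> x"
    using assms(3) by (rule LIMSEQ_ignore_initial_segment)
  ultimately show False using assms(2) by simp
qed

text \<open>The point \<open>x + \<sigma> * \<tau>\<close> is the end of the immediate basin in
  direction \<open>\<sigma>\<close>. The basin contains no preimage of 0, so the \<open>q\<close>-th
  iterate is monotone up to that end and, its multiplier at \<open>x\<close> being nonnegative,
  fixes it. The end cannot attract, because the points just before it converge to
  \<open>x\<close>.\<close>

lemma basin_edge:
  assumes a: "0 < a" and q: "0 < q" and fixed: "(quad a ^^ q) x = x"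
    and D: "0 \<le> quad_secant a q x x" "quad_secant a q x x < 1"
    and na: "\<And>j. \<not> (\<lambda>n. (quad a ^^ (j + q * n)) 0) \<longlonglongrightarrow> x"
    and \<sigma>: "\<bar>\<sigma>\<bar> = 1"
  obtains \<tau> where "0 < \<tau>" "(quad a ^^ q) (x + \<sigma> * \<tau>) = x + \<sigma> * \<tau>"
    "1 \<le> quad_secant a q (x + \<sigma> * \<tau>) (x + \<sigma> * \<tau>)" "same_side a x (x + \<sigma> * \<tau>)"
proof -
  define att where "att y \<longleftrightarrow> (\<lambda>n. (quad a ^^ (q * n)) y) \<longlonglongrightarrow> x" for y
  have nz: "(quad a ^^ i) w \<noteq> 0" if "att w" for w i
    using basin_avoids_zero[OF q na] that unfolding att_def by blast
  have attx: "att x" unfolding att_def using quad_pow_mult_fixed[OF fixed] by simp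
  have Dpos: "0 < quad_secant a q x x"
    using nz[OF attx] a D(1) by (auto simp: quad_secant_def order.order_iff_strict)
  have attpow: "att y \<longleftrightarrow> att ((quad a ^^ (q * m)) y)" for y m
  proof -
    have "(quad a ^^ (q * n)) ((quad a ^^ (q * m)) y) = (quad a ^^ (q * (n + m))) y" for n
      by (simp add: quad_pow_add[symmetric] algebra_simps)
    then show ?thesis unfolding att_def
      using LIMSEQ_ignore_initial_segment[of "\<lambda>n. (quad a ^^ (q * n)) y" x m]
        LIMSEQ_offset[of "\<lambda>n. (quad a ^^ (q * n)) y" m x] by auto
  qed
  have attg: "att y \<longleftrightarrow> att ((quad a ^^ q) y)" for y using attpow[of y 1] by simp
  obtain r where r: "0 < r" "\<And>y. \<bar>y - x\<bar> < r \<Longrightarrow> att y"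
    using local_attraction[OF fixed, of thesis] D unfolding att_def by force
  define B where "B = \<bar>x\<bar> + 3 / a + 1"
  have bounded: "\<bar>y\<bar> \<le> B" if "att y" for y
  proof (rule ccontr)
    assume "\<not> \<bar>y\<bar> \<le> B"
    then have y: "\<bar>x\<bar> + 3 / a + 1 < \<bar>y\<bar>" by (simp add: B_def)
    have "0 < 3 / a" using a by simp
    then have "\<bar>y\<bar> \<le> \<bar>(quad a ^^ (q * n)) y\<bar>" for n
      using y by (intro quad_pow_escape[OF a]) linarith+
    moreover have "(\<lambda>n. \<bar>(quad a ^^ (q * n)) y\<bar>) \<longlonglongrightarrow> \<bar>x\<bar>"
      using that unfolding att_def by (rule tendsto_rabs)
    ultimately have "\<bar>y\<bar> \<le> \<bar>x\<bar>" by (intro LIMSEQ_le_const) auto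
    then show False using y \<open>0 < 3 / a\<close> by linarith
  qed
  \<comment> \<open>Asking for the whole segment from \<open>x\<close> to lie in the basin singles
    out the immediate basin.\<close>
  define R where "R = {t. 0 \<le> t \<and> (\<forall>s\<in>{0..t}. att (x + \<sigma> * s))}"
  define \<tau> where "\<tau> = Sup R"
  have "R \<noteq> {}" using attx by (auto simp: R_def intro!: exI[of _ 0])
  have bdd: "bdd_above R"
  proof (rule bdd_aboveI)
    fix t assume "t \<in> R"
    then have "0 \<le> t" "\<bar>x + \<sigma> * t\<bar> \<le> B" using bounded by (auto simp: R_def)
    moreover have "\<bar>\<sigma> * t\<bar> = \<bar>t\<bar>" using \<sigma> by (simp add: abs_mult)
    ultimately show "t \<le> B + \<bar>x\<bar>" by linarith
  qed
  have "r / 2 \<in> R"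
    using r by (auto simp: R_def abs_mult \<sigma>)
  then have "r / 2 \<le> \<tau>" unfolding \<tau>_def using bdd by (rule cSup_upper)
  then have \<tau>: "0 < \<tau>" using r(1) by linarith
  have below: "att (x + \<sigma> * t)" if "0 \<le> t" "t < \<tau>" for t
  proof -
    obtain u where "u \<in> R" "t < u"
      using \<open>t < \<tau>\<close> less_cSup_iff[OF \<open>R \<noteq> {}\<close> bdd] unfolding \<tau>_def by blast
    then show ?thesis using that by (auto simp: R_def)
  qed
  \<comment> \<open>The basin is open: some iterate enters the attracting ball, and nearby points
    follow. If the end belonged to the basin, the segment could be prolonged.\<close>
  have edge: "\<not> att (x + \<sigma> * \<tau>)"
  proof
    assume "att (x + \<sigma> * \<tau>)"
    then have "\<forall>\<^sub>F n in sequentially. dist ((quad a ^^ (q * n)) (x + \<sigma> * \<tau>)) x < r"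
      unfolding att_def using r(1) by (rule tendstoD)
    then obtain n where n: "\<bar>(quad a ^^ (q * n)) (x + \<sigma> * \<tau>) - x\<bar> < r"
      unfolding dist_real_def eventually_sequentially by blast
    have "((\<lambda>t. \<bar>(quad a ^^ (q * n)) (x + \<sigma> * t) - x\<bar>) \<longlongrightarrow>
        \<bar>(quad a ^^ (q * n)) (x + \<sigma> * \<tau>) - x\<bar>) (nhds \<tau>)"
      by (intro tendsto_intros filterlim_ident)
    then have "\<forall>\<^sub>F t in nhds \<tau>. \<bar>(quad a ^^ (q * n)) (x + \<sigma> * t) - x\<bar> < r"
      using n by (rule order_tendstoD)
    then obtain e where e: "0 < e" "\<And>t. \<bar>t - \<tau>\<bar> < e \<Longrightarrow> \<bar>(quad a ^^ (q * n)) (x + \<sigma> * t) - x\<bar> < r"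
      unfolding eventually_nhds_metric dist_real_def by blast
    have near: "att (x + \<sigma> * t)" if "\<bar>t - \<tau>\<bar> < e" for t
      using attpow r(2) e(2)[OF that] by blast
    have "att (x + \<sigma> * t)" if "t \<in> {0..\<tau> + e / 2}" for t
    proof (cases "t < \<tau>")
      case True
      then show ?thesis using below that by simp
    next
      case False
      then show ?thesis using near that e(1) by simp
    qed
    then have "\<tau> + e / 2 \<in> R" using \<tau> e(1) by (simp add: R_def)
    then have "\<tau> + e / 2 \<le> \<tau>" unfolding \<tau>_def using bdd by (rule cSup_upper)
    then show False using e(1) by simp
  qed
  \<comment> \<open>A sign change along the segment would, by the intermediate value theorem, put a
    preimage of 0 strictly before the end, inside the basin.\<close>
  have side: "same_side a x (x + \<sigma> * \<tau>)"
    unfolding same_side_def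
  proof (rule allI, rule ccontr)
    fix i
    let ?h = "\<lambda>s. (quad a ^^ i) x * (quad a ^^ i) (x + \<sigma> * s)"
    assume "\<not> 0 \<le> ?h \<tau>"
    moreover have "0 \<le> ?h 0" by simp
    moreover have "continuous_on {0..\<tau>} ?h" by (intro continuous_intros)
    ultimately obtain w where w: "w \<in> {0..\<tau>}" "?h w = 0"
      using IVT_between[of 0 \<tau> ?h \<tau> 0 0] \<tau> by auto
    then have "w < \<tau>" using \<open>\<not> 0 \<le> ?h \<tau>\<close> by (cases "w = \<tau>") auto
    then show False using w nz[OF below] nz[OF attx] by auto
  qed
  \<comment> \<open>\<open>h\<close> is the \<open>q\<close>-th iterate in the coordinate
    \<open>t\<close>. The end cannot move inwards, as it would then lie in the basin, nor outwards,
    as an inner point would then be mapped onto it.\<close>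
  define h where "h t = quad_secant a q (x + \<sigma> * t) x * t" for t
  have h: "(quad a ^^ q) (x + \<sigma> * t) = x + \<sigma> * h t" for t
    using quad_pow_diff[of q a "x + \<sigma> * t" x] fixed by (simp add: h_def algebra_simps)
  have "0 \<le> quad_secant a q (x + \<sigma> * \<tau>) x"
    using quad_secant_same_side(1)[OF side, of q] Dpos by (simp add: zero_le_mult_iff)
  then have "0 \<le> h \<tau>" using \<tau> by (simp add: h_def)
  have "\<not> h \<tau> < \<tau>"
    using below[of "h \<tau>"] edge attg[of "x + \<sigma> * \<tau>"] \<open>0 \<le> h \<tau>\<close> by (auto simp: h)
  moreover have "\<not> \<tau> < h \<tau>"
  proof
    assume "\<tau> < h \<tau>"
    moreover have "h 0 \<le> \<tau>" using \<tau> by (simp add: h_def)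
    moreover have "continuous_on {0..\<tau>} h" unfolding h_def by (intro continuous_intros)
    ultimately obtain w where w: "w \<in> {0..\<tau>}" "h w = \<tau>"
      using IVT_between[of 0 \<tau> h 0 \<tau> \<tau>] \<tau> by auto
    then have "w < \<tau>" using \<open>\<tau> < h \<tau>\<close> by (cases "w = \<tau>") auto
    then have "att (x + \<sigma> * w)" using below w by simp
    then show False using edge attg[of "x + \<sigma> * w"] w by (simp add: h)
  qed
  ultimately have fixb: "(quad a ^^ q) (x + \<sigma> * \<tau>) = x + \<sigma> * \<tau>" by (simp add: h)
  have "1 \<le> quad_secant a q (x + \<sigma> * \<tau>) (x + \<sigma> * \<tau>)"
  proof (rule ccontr)
    let ?b = "x + \<sigma> * \<tau>"
    assume "\<not> 1 \<le> quad_secant a q ?b ?b"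
    moreover have "0 \<le> quad_secant a q ?b ?b"
      using quad_secant_same_side(2)[OF side, of q] Dpos by (simp add: zero_le_mult_iff)
    ultimately obtain r' where r': "0 < r'"
      "\<And>y. \<bar>y - ?b\<bar> < r' \<Longrightarrow> (\<lambda>n. (quad a ^^ (q * n)) y) \<longlonglongrightarrow> ?b"
      using local_attraction[OF fixb, of thesis] by force
    define t where "t = max 0 (\<tau> - r' / 2)"
    have t: "0 \<le> t" "t < \<tau>" "\<bar>t - \<tau>\<bar> < r'" using \<tau> r'(1) by (auto simp: t_def)
    have "\<bar>(x + \<sigma> * t) - ?b\<bar> = \<bar>\<sigma>\<bar> * \<bar>t - \<tau>\<bar>"
      unfolding abs_mult[symmetric] by (simp add: algebra_simps)
    then have "(\<lambda>n. (quad a ^^ (q * n)) (x + \<sigma> * t)) \<longlonglongrightarrow> ?b"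
      using t(3) \<sigma> by (intro r') simp
    moreover have "(\<lambda>n. (quad a ^^ (q * n)) (x + \<sigma> * t)) \<longlonglongrightarrow> x"
      using below[OF t(1,2)] unfolding att_def .
    ultimately have "?b = x" by (rule LIMSEQ_unique)
    then show False using \<tau> \<sigma> by auto
  qed
  with \<tau> fixb side that show ?thesis by blast
qed

text \<open>Otherwise both ends of the immediate basin are fixed points of multiplier at least 1 on
  the same side, contrary to \<open>multiplier_product_less_one\<close>. Cycles of negative
  multiplier are brought into this form by doubling the period.\<close>

lemma attracting_fixed_point_attracts_zero:
  assumes a: "0 < a" and q: "0 < q" and fixed: "(quad a ^^ q) x = x"
    and D: "0 \<le> quad_secant a q x x" "quad_secant a q x x < 1"
  obtains j where "(\<lambda>n. (quad a ^^ (j + q * n)) 0) \<longlonglongrightarrow> x"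
proof (rule ccontr)
  assume "\<not> thesis"
  then have na: "\<And>j. \<not> (\<lambda>n. (quad a ^^ (j + q * n)) 0) \<longlonglongrightarrow> x" using that by blast
  have nz: "(quad a ^^ i) x \<noteq> 0" for i
    using basin_avoids_zero[OF q na] quad_pow_mult_fixed[OF fixed] by simp
  obtain s where s: "0 < s" "(quad a ^^ q) (x + 1 * s) = x + 1 * s"
    "1 \<le> quad_secant a q (x + 1 * s) (x + 1 * s)" "same_side a x (x + 1 * s)"
    by (rule basin_edge[OF a q fixed D na, of 1]) auto
  obtain t where t: "0 < t" "(quad a ^^ q) (x + (- 1) * t) = x + (- 1) * t"
    "1 \<le> quad_secant a q (x + (- 1) * t) (x + (- 1) * t)" "same_side a x (x + (- 1) * t)"
    by (rule basin_edge[OF a q fixed D na, of "- 1"]) auto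
  have "quad_secant a q (x + 1 * s) (x + 1 * s) * quad_secant a q (x + (- 1) * t) (x + (- 1) * t) < 1"
    using a q s t same_side_cong[OF nz s(4) t(4)]
    by (intro multiplier_product_less_one) auto
  moreover have "1 * 1 \<le> quad_secant a q (x + 1 * s) (x + 1 * s) *
      quad_secant a q (x + (- 1) * t) (x + (- 1) * t)"
    using s(3) t(3) by (intro mult_mono) auto
  ultimately show False by simp
qed

subsection \<open>Parameters with a superstable orbit\<close>

text \<open>Preimages of 0 accumulate at \<open>x\<close> from side \<open>\<sigma>\<close>; a sign
  change is recorded instead of a zero because it survives a change of parameter. Without one, a
  maximal segment of monotonicity would contain a second fixed point of the \<open>q\<close>-th
  iterate, and the product of the two multipliers would be both at least 1 and less than 1.\<close>

lemma repelling_sign_change: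
  assumes a: "0 < a" "a \<le> 2" and q: "0 < q" and fixed: "(quad a ^^ q) x = x"
    and D: "1 < quad_secant a q x x"
    and na: "\<And>b. (quad a ^^ q) b = b \<Longrightarrow> 0 \<le> quad_secant a q b b \<Longrightarrow> 1 \<le> quad_secant a q b b"
    and \<sigma>: "\<bar>\<sigma>\<bar> = 1" and \<delta>: "0 < \<delta>" and I: "x \<in> ivl_I" "x + \<sigma> * \<delta> \<in> ivl_I"
  obtains k s t where "s \<in> {0<..<\<delta>}" "t \<in> {0<..<\<delta>}"
    "(quad a ^^ k) (x + \<sigma> * s) < 0" "0 < (quad a ^^ k) (x + \<sigma> * t)"
proof (rule ccontr)
  assume "\<not> thesis"
  with that have no: "\<not> (s \<in> {0<..<\<delta>} \<and> t \<in> {0<..<\<delta>} \<and>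
    (quad a ^^ k) (x + \<sigma> * s) < 0 \<and> 0 < (quad a ^^ k) (x + \<sigma> * t))" for s t k
    by blast
  have nz: "(quad a ^^ i) x \<noteq> 0" for i using quad_pow_nonzero[OF fixed q] D by simp
  \<comment> \<open>\<open>\<tau>\<close> is the length of the longest segment from \<open>x\<close>
    whose points keep to the side of \<open>x\<close> at all times; \<open>ivl_I\<close> bounds it.
    As \<open>A\<close> is closed, the end is included.\<close>
  define A where "A = {t. same_side a x (x + \<sigma> * t) \<and> x + \<sigma> * t \<in> ivl_I}"
  define S where "S = {t. 0 \<le> t \<and> {0..t} \<subseteq> A}"
  define \<tau> where "\<tau> = Sup S"
  have "closed A"
    unfolding A_def same_side_def atLeastAtMost_iff
    by (intro closed_Collect_conj closed_Collect_all closed_Collect_le continuous_intros)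
  have "t \<in> A" if t: "0 \<le> t" "t < \<delta>" for t
  proof -
    have "x + \<sigma> * t = x \<or> x + \<sigma> * t \<in> ivl_I"
      using I t \<sigma> by (auto simp: abs_if split: if_splits)
    moreover have "0 \<le> (quad a ^^ i) x * (quad a ^^ i) (x + \<sigma> * t)" for i
    proof (rule ccontr)
      let ?h = "\<lambda>s. (quad a ^^ i) x * (quad a ^^ i) (x + \<sigma> * s)"
      assume neg: "\<not> 0 \<le> ?h t"
      have pos: "0 < ?h 0" using nz[of i] by (simp add: zero_less_mult_iff linorder_neq_iff disj_commute)
      have "continuous_on {0..t} ?h" by (intro continuous_intros)
      \<comment> \<open>Aiming at half of the value at 0 makes \<open>w\<close> nonzero, so
        \<open>w\<close> and \<open>t\<close> both lie in the open range and carry opposite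
        signs.\<close>
      then obtain w where w: "w \<in> {0..t}" "?h w = ?h 0 / 2"
        using IVT_between[of 0 t ?h t 0 "?h 0 / 2"] t neg pos by auto
      have "w \<noteq> 0" using w pos by auto
      moreover have "t \<noteq> 0" using neg pos by auto
      moreover have "0 < ?h w" using pos by (subst w(2)) simp
      ultimately show False
        using w t neg no[of t w i] no[of w t i]
        by (cases "0 < (quad a ^^ i) x") (auto simp: not_le zero_less_mult_iff mult_less_0_iff)
    qed
    ultimately show ?thesis using I(1) by (auto simp: A_def same_side_def)
  qed
  then have "\<delta> / 2 \<in> S" using \<delta> by (auto simp: S_def)
  have bdd: "bdd_above S"
  proof (rule bdd_aboveI)
    fix t assume "t \<in> S"
    then have "0 \<le> t" "x + \<sigma> * t \<in> ivl_I" by (auto simp: S_def A_def)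
    then show "t \<le> 2" using I(1) \<sigma> by (auto simp: abs_if split: if_splits)
  qed
  have "\<delta> / 2 \<le> \<tau>" unfolding \<tau>_def using \<open>\<delta> / 2 \<in> S\<close> bdd by (rule cSup_upper)
  then have \<tau>: "0 < \<tau>" using \<delta> by linarith
  have "{0..<\<tau>} \<subseteq> A"
  proof
    fix t assume t: "t \<in> {0..<\<tau>}"
    then obtain u where "u \<in> S" "t < u"
      using less_cSup_iff[OF _ bdd] \<open>\<delta> / 2 \<in> S\<close> unfolding \<tau>_def by auto
    then show "t \<in> A" using t by (auto simp: S_def)
  qed
  then have "closure {0..<\<tau>} \<subseteq> A" using \<open>closed A\<close> by (rule closure_minimal)
  then have A: "{0..\<tau>} \<subseteq> A" using \<tau> by simp
  define h where "h t = quad_secant a q (x + \<sigma> * t) x * t" for t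
  have h: "(quad a ^^ q) (x + \<sigma> * t) = x + \<sigma> * h t" for t
    using quad_pow_diff[of q a "x + \<sigma> * t" x] fixed by (simp add: h_def algebra_simps)
  have conth: "continuous_on {0..\<tau>} h" unfolding h_def by (intro continuous_intros)
  \<comment> \<open>The sign of an image at time \<open>i\<close> is the sign of the original at
    time \<open>i + q\<close>, so the image of the segment again has the required signs. Were it
    longer, \<open>\<tau>\<close> would not be maximal.\<close>
  have "h \<tau> \<le> \<tau>"
  proof (rule ccontr)
    assume gt: "\<not> h \<tau> \<le> \<tau>"
    have "t \<in> A" if "t \<in> {0..h \<tau>}" for t
    proof -
      have "h 0 \<le> t" "t \<le> h \<tau>" using that by (simp_all add: h_def)
      then obtain w where w: "w \<in> {0..\<tau>}" "h w = t"
        using IVT_between[OF conth, of 0 \<tau> t] \<tau> by auto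
      then have "w \<in> A" using A by blast
      have "0 \<le> (quad a ^^ i) x * (quad a ^^ i) (x + \<sigma> * t)" for i
      proof -
        have "(quad a ^^ i) x = (quad a ^^ (i + q)) x"
          "(quad a ^^ i) (x + \<sigma> * t) = (quad a ^^ (i + q)) (x + \<sigma> * w)"
          using w(2) fixed by (simp_all only: quad_pow_add h)
        then show ?thesis using \<open>w \<in> A\<close> unfolding A_def same_side_def by simp
      qed
      moreover have "x + \<sigma> * t \<in> ivl_I"
        using quad_pow_in_ivl[OF a, of "x + \<sigma> * w" q] \<open>w \<in> A\<close> w(2) by (simp add: A_def h)
      ultimately show ?thesis by (simp add: A_def same_side_def)
    qed
    then have "h \<tau> \<in> S" using gt \<tau> by (auto simp: S_def)
    then have "h \<tau> \<le> \<tau>" unfolding \<tau>_def using bdd by (rule cSup_upper)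
    then show False using gt by simp
  qed
  then have "quad_secant a q (x + \<sigma> * \<tau>) x \<le> 1" using \<tau> by (simp add: h_def)
  moreover have "continuous_on {0..\<tau>} (\<lambda>t. quad_secant a q (x + \<sigma> * t) x)"
    by (intro continuous_intros)
  \<comment> \<open>The secant slope to \<open>x\<close> exceeds 1 at \<open>x\<close> and is at
    most 1 at the end; where it equals 1 there is a second fixed point.\<close>
  ultimately obtain w where w: "w \<in> {0..\<tau>}" "quad_secant a q (x + \<sigma> * w) x = 1"
    using IVT_between[of 0 \<tau> "\<lambda>t. quad_secant a q (x + \<sigma> * t) x" \<tau> 0 1] \<tau> D by auto
  let ?b = "x + \<sigma> * w"
  have "w \<noteq> 0" using w D by auto
  then have "x \<noteq> ?b" using \<sigma> by auto
  have fixb: "(quad a ^^ q) ?b = ?b" using w by (simp add: h h_def)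
  have side: "same_side a x ?b" using w A by (auto simp: A_def)
  have "quad_secant a q x x * quad_secant a q ?b ?b < 1"
    using a q \<open>x \<noteq> ?b\<close> fixed fixb side by (intro multiplier_product_less_one) auto
  moreover have b0: "0 \<le> quad_secant a q ?b ?b"
    using quad_secant_same_side(2)[OF side, of q] D by (simp add: zero_le_mult_iff)
  moreover have "1 * 1 \<le> quad_secant a q x x * quad_secant a q ?b ?b"
    using D na[OF fixb b0] by (intro mult_mono) auto
  ultimately show False by simp
qed

text \<open>By Singer's theorem an attracting \<open>b\<close> would be a limit of the critical
  orbit along steps of \<open>q\<close>. These steps are eventually constant on the cycle of
  \<open>x\<close>, so \<open>b\<close> lies on this cycle and has its multiplier, which exceeds
  1.\<close>

lemma pcf_no_attracting_fixed_point:
  assumes a: "0 < a" and q: "0 < q" and x: "x = (quad a ^^ N) 0" "(quad a ^^ q) x = x"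
    and D: "1 < quad_secant a q x x"
    and b: "(quad a ^^ q) b = b" "0 \<le> quad_secant a q b b"
  shows "1 \<le> quad_secant a q b b"
proof (rule ccontr)
  assume "\<not> 1 \<le> quad_secant a q b b"
  then obtain j where j: "(\<lambda>n. (quad a ^^ (j + q * n)) 0) \<longlonglongrightarrow> b"
    using attracting_fixed_point_attracts_zero[OF a q b] by force
  define i where "i = j + q * N - N"
  have "(quad a ^^ (j + q * (n + N))) 0 = (quad a ^^ i) x" for n
  proof -
    have "N \<le> q * N" using q by simp
    then have "j + q * (n + N) = i + (q * n + N)"
      unfolding i_def distrib_left by linarith
    then show ?thesis using quad_pow_mult_fixed[OF x(2)] by (simp only: quad_pow_add x(1)[symmetric])
  qed
  then have "(\<lambda>n. (quad a ^^ i) x) \<longlonglongrightarrow> b"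
    using LIMSEQ_ignore_initial_segment[OF j, of N] by simp
  then have "b = (quad a ^^ i) x" by (simp add: LIMSEQ_const_iff)
  then have "quad_secant a q b b = quad_secant a q x x"
    using quad_secant_orbit[OF x(2) q] D by simp
  then show False using D \<open>\<not> 1 \<le> quad_secant a q b b\<close> by simp
qed

section \<open>Non-persistence of the critical relation\<close>

text \<open>Polynomials in the parameter: a relation between critical iterates is either an identity
  or has finitely many solutions.\<close>

primrec critical_poly :: "nat \<Rightarrow> real poly" where
  "critical_poly 0 = 0"
| "critical_poly (Suc n) = 1 - [:0, 1:] * (critical_poly n)\<^sup>2"

lemma poly_critical_poly: "poly (critical_poly n) a = (quad a ^^ n) 0"
  by (induction n) (simp_all add: quad_pow_Suc del: funpow.simps(2))

text \<open>At the parameter 3 the critical orbit escapes, so the polynomial relation is nontrivial.\<close>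

lemma finite_critical_relation:
  assumes "0 < q"
  shows "finite {a. (quad a ^^ (q + N)) 0 = (quad a ^^ N) 0}"
proof -
  have grow: "\<bar>(quad 3 ^^ n) 0\<bar> < \<bar>(quad 3 ^^ Suc n) 0\<bar> \<and> 1 \<le> \<bar>(quad 3 ^^ Suc n) 0\<bar>" for n
  proof (induction n)
    case (Suc n)
    let ?w = "(quad 3 ^^ Suc n) 0"
    have w: "1 \<le> \<bar>?w\<bar>" using Suc by blast
    then have "1 * \<bar>?w\<bar> \<le> \<bar>?w\<bar> * \<bar>?w\<bar>" by (intro mult_right_mono) auto
    then have "\<bar>?w\<bar> \<le> ?w\<^sup>2" by (simp add: power2_eq_square flip: abs_mult)
    then have "\<bar>?w\<bar> < \<bar>1 - 3 * ?w\<^sup>2\<bar>" using w by linarith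
    then have "\<bar>?w\<bar> < \<bar>(quad 3 ^^ Suc (Suc n)) 0\<bar>" by (subst quad_pow_Suc)
    then show ?case using w by linarith
  qed (simp add: quad_def)
  have "\<bar>(quad 3 ^^ N) 0\<bar> < \<bar>(quad 3 ^^ (q + N)) 0\<bar>"
    using lift_Suc_mono_less[of "\<lambda>n. \<bar>(quad 3 ^^ n) 0\<bar>" N "q + N"] grow assms by auto
  then have "poly (critical_poly (q + N) - critical_poly N) 3 \<noteq> 0"
    by (auto simp: poly_critical_poly)
  then have "critical_poly (q + N) - critical_poly N \<noteq> 0" by auto
  then have "finite {a. poly (critical_poly (q + N) - critical_poly N) a = 0}"
    by (rule poly_roots_finite)
  then show ?thesis by (simp add: poly_critical_poly)
qed

section \<open>Leaving the repelling cycle and returning to the critical point\<close>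

text \<open>The orbit is compared with its own shift by \<open>q\<close> steps, so \<open>x\<close>
  is not assumed to be fixed and may come from another parameter. Displacements over
  \<open>q\<close> steps grow at least by the factor \<open>\<kappa>\<close>, while near
  \<open>x\<close> they stay below \<open>2 * \<delta>\<close>.\<close>

lemma expanding_exit:
  assumes lam: "1 < \<kappa>"
    and E: "\<And>y z. \<bar>y - x\<bar> < \<delta> \<Longrightarrow> \<bar>z - x\<bar> < \<delta> \<Longrightarrow> \<kappa> < quad_secant a q y z"
    and neq: "(quad a ^^ q) y \<noteq> y"
  obtains n where "\<delta> \<le> \<bar>(quad a ^^ (q * n)) y - x\<bar>"
proof (rule ccontr)
  assume "\<not> thesis"
  then have near: "\<bar>(quad a ^^ (q * n)) y - x\<bar> < \<delta>" for n by (meson not_le that)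
  define d where "d = \<bar>(quad a ^^ q) y - y\<bar>"
  have "0 < d" using neq by (simp add: d_def)
  have grow: "\<kappa> ^ n * d \<le> \<bar>(quad a ^^ (q * Suc n)) y - (quad a ^^ (q * n)) y\<bar>" for n
  proof (induction n)
    case (Suc n)
    let ?u = "(quad a ^^ (q * Suc n)) y" and ?v = "(quad a ^^ (q * n)) y"
    have "\<kappa> \<le> \<bar>quad_secant a q ?u ?v\<bar>" using E[OF near near, of "Suc n" n] by linarith
    then have "\<kappa> * (\<kappa> ^ n * d) \<le> \<bar>quad_secant a q ?u ?v\<bar> * \<bar>?u - ?v\<bar>"
      using Suc lam \<open>0 < d\<close> by (intro mult_mono) auto
    also have "\<dots> = \<bar>(quad a ^^ q) ?u - (quad a ^^ q) ?v\<bar>"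
      by (simp only: quad_pow_diff abs_mult)
    finally show ?case by (simp add: quad_pow_add[symmetric] mult.assoc del: funpow.simps)
  qed (simp add: d_def)
  obtain n where n: "2 * \<delta> / d < \<kappa> ^ n" using real_arch_pow[OF lam] by blast
  then have "2 * \<delta> < \<kappa> ^ n * d" using \<open>0 < d\<close> by (simp add: field_simps)
  then show False using grow[of n] near[of n] near[of "Suc n"] by linarith
qed

text \<open>Strict signs persist for nearby parameters. The conclusion is conditional because
  \<open>x\<close> may be an endpoint of \<open>ivl_I\<close> with no room on one side, for example
  \<open>x = -1\<close> at \<open>a = 2\<close>.\<close>

lemma robust_sign_change:
  assumes a: "0 < a" "a \<le> 2" and q: "0 < q" and x: "x = (quad a ^^ N) 0" "(quad a ^^ q) x = x"
    and D: "1 < quad_secant a q x x"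
    and \<sigma>: "\<bar>\<sigma>\<bar> = 1" and \<delta>: "0 < \<delta>"
  obtains k s t \<eta> where "0 < \<eta>" "x + \<sigma> * \<delta> \<in> ivl_I \<Longrightarrow> s \<in> {0<..<\<delta>} \<and> t \<in> {0<..<\<delta>} \<and>
    (\<forall>b. \<bar>b - a\<bar> < \<eta> \<longrightarrow> (quad b ^^ k) (x + \<sigma> * s) < 0 \<and> 0 < (quad b ^^ k) (x + \<sigma> * t))"
proof (cases "x + \<sigma> * \<delta> \<in> ivl_I")
  case True
  have "x \<in> ivl_I" using quad_pow_in_ivl[OF a, of 0 N] by (simp add: x(1))
  then obtain k s t where st: "s \<in> {0<..<\<delta>}" "t \<in> {0<..<\<delta>}"
    and k: "(quad a ^^ k) (x + \<sigma> * s) < 0" "0 < (quad a ^^ k) (x + \<sigma> * t)"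
    using repelling_sign_change[OF a q x(2) D _ \<sigma> \<delta> _ True]
      pcf_no_attracting_fixed_point[OF a(1) q x D] by metis
  have lim: "((\<lambda>b. (quad b ^^ k) y) \<longlongrightarrow> (quad a ^^ k) y) (nhds a)" for y
    by (intro tendsto_intros filterlim_ident)
  have "\<forall>\<^sub>F b in nhds a. (quad b ^^ k) (x + \<sigma> * s) < 0 \<and> 0 < (quad b ^^ k) (x + \<sigma> * t)"
    using order_tendstoD(2)[OF lim k(1)] order_tendstoD(1)[OF lim k(2)] by (rule eventually_conj)
  then show ?thesis using that st unfolding eventually_nhds_metric dist_real_def by blast
qed (use that[of 1] in auto)

text \<open>The critical orbit of \<open>b\<close> is near \<open>x\<close> after \<open>N\<close>
  steps, follows the cycle for \<open>q * n\<close> steps, and is back at 0 after at most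
  \<open>k1 + k2\<close> more. The middle stretch, where \<open>\<phi>\<close> exceeds
  \<open>1 / 2\<close>, is at least half of \<open>L\<close>; hence the average of at least
  \<open>1 / 4\<close>.\<close>

lemma superstable_perturbation:
  fixes \<phi> :: "real \<Rightarrow> real"
  assumes a: "0 < a" "a \<le> 2" and q: "0 < q" and x: "x = (quad a ^^ N) 0" "(quad a ^^ q) x = x"
    and D: "1 < quad_secant a q x x"
    and \<phi>: "continuous_on UNIV \<phi>" "\<And>y. 0 \<le> \<phi> y" "\<And>j. 1 / 2 < \<phi> ((quad a ^^ j) x)"
    and \<epsilon>: "0 < \<epsilon>"
  obtains b L where "0 < b" "b < a" "a - \<epsilon> < b" "0 < L" "(quad b ^^ L) 0 = 0"
    "real L / 4 \<le> (\<Sum>i<L. \<phi> ((quad b ^^ i) 0))"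
proof -
  define \<kappa> where "\<kappa> = (1 + quad_secant a q x x) / 2"
  have lam: "1 < \<kappa>" "\<kappa> < quad_secant a q x x" using D by (auto simp: \<kappa>_def)
  \<comment> \<open>The product filters yield one radius \<open>\<eta>\<close> for parameters and
    one radius \<open>\<delta>\<close> around \<open>x\<close> such that secant slopes exceed
    \<open>\<kappa>\<close>, and \<open>\<phi>\<close> exceeds \<open>1 / 2\<close> during one full
    turn.\<close>
  have "((\<lambda>p. quad_secant (fst p) q (fst (snd p)) (snd (snd p))) \<longlongrightarrow> quad_secant a q x x)
      (nhds a \<times>\<^sub>F (nhds x \<times>\<^sub>F nhds x))"
    by (intro tendsto_intros filterlim_fst filterlim_compose[OF filterlim_fst filterlim_snd]
      filterlim_compose[OF filterlim_snd filterlim_snd])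
  then have "\<forall>\<^sub>F p in nhds a \<times>\<^sub>F (nhds x \<times>\<^sub>F nhds x).
      \<kappa> < quad_secant (fst p) q (fst (snd p)) (snd (snd p))"
    using lam(2) by (rule order_tendstoD)
  then obtain P R where P: "eventually P (nhds a)" "eventually R (nhds x \<times>\<^sub>F nhds x)"
      "\<And>b p. P b \<Longrightarrow> R p \<Longrightarrow> \<kappa> < quad_secant b q (fst p) (snd p)"
    unfolding eventually_prod_filter[of _ "nhds a"] by auto
  obtain Q where Q: "eventually Q (nhds x)" "\<And>y z. Q y \<Longrightarrow> Q z \<Longrightarrow> R (y, z)"
    using P(2) unfolding eventually_prod_same by blast
  have "((\<lambda>p. \<phi> ((quad (fst p) ^^ j) (snd p))) \<longlongrightarrow> \<phi> ((quad a ^^ j) x))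
      (nhds a \<times>\<^sub>F nhds x)" for j
    using \<phi>(1) by (intro isCont_tendsto_compose[of _ \<phi>] tendsto_intros filterlim_fst filterlim_snd)
      (simp add: continuous_on_eq_continuous_at)
  then have "\<forall>\<^sub>F p in nhds a \<times>\<^sub>F nhds x. \<forall>j\<in>{..<q}. 1 / 2 < \<phi> ((quad (fst p) ^^ j) (snd p))"
    using \<phi>(3) by (intro eventually_ball_finite ballI order_tendstoD(1)) auto
  then obtain P' Q' where P': "eventually P' (nhds a)" "eventually Q' (nhds x)"
      "\<And>b y j. P' b \<Longrightarrow> Q' y \<Longrightarrow> j < q \<Longrightarrow> 1 / 2 < \<phi> ((quad b ^^ j) y)"
    unfolding eventually_prod_filter by auto
  obtain \<eta> where \<eta>: "0 < \<eta>" "\<And>b. \<bar>b - a\<bar> < \<eta> \<Longrightarrow> P b \<and> P' b"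
    using eventually_conj[OF P(1) P'(1)] unfolding eventually_nhds_metric dist_real_def by blast
  obtain \<delta> where \<delta>: "0 < \<delta>" "\<And>y. \<bar>y - x\<bar> < \<delta> \<Longrightarrow> Q y \<and> Q' y"
    using eventually_conj[OF Q(1) P'(2)] unfolding eventually_nhds_metric dist_real_def by blast
  have E: "\<kappa> < quad_secant b q y z" if "\<bar>b - a\<bar> < \<eta>" "\<bar>y - x\<bar> < \<delta>" "\<bar>z - x\<bar> < \<delta>" for b y z
    using P(3)[of b "(y, z)"] Q(2) \<eta>(2) \<delta>(2) that by auto
  have \<phi>': "1 / 2 < \<phi> ((quad b ^^ j) y)" if "\<bar>b - a\<bar> < \<eta>" "\<bar>y - x\<bar> < \<delta>" "j < q" for b y j
    using P'(3) \<eta>(2) \<delta>(2) that by blast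
  \<comment> \<open>Both sides of \<open>x\<close> are prepared, since it is not known on which side
    the orbit will leave.\<close>
  obtain k1 s1 t1 \<eta>1 where \<eta>1: "0 < \<eta>1"
    and c1: "x + 1 * \<delta> \<in> ivl_I \<Longrightarrow> s1 \<in> {0<..<\<delta>} \<and> t1 \<in> {0<..<\<delta>} \<and>
      (\<forall>b. \<bar>b - a\<bar> < \<eta>1 \<longrightarrow> (quad b ^^ k1) (x + 1 * s1) < 0 \<and> 0 < (quad b ^^ k1) (x + 1 * t1))"
    using robust_sign_change[OF a q x D _ \<delta>(1), of 1] by (metis abs_one)
  obtain k2 s2 t2 \<eta>2 where \<eta>2: "0 < \<eta>2"
    and c2: "x + (- 1) * \<delta> \<in> ivl_I \<Longrightarrow> s2 \<in> {0<..<\<delta>} \<and> t2 \<in> {0<..<\<delta>} \<and>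
      (\<forall>b. \<bar>b - a\<bar> < \<eta>2 \<longrightarrow> (quad b ^^ k2) (x + (- 1) * s2) < 0 \<and>
        0 < (quad b ^^ k2) (x + (- 1) * t2))"
    using robust_sign_change[OF a q x D _ \<delta>(1), of "- 1"] by (metis abs_minus_cancel abs_one)
  \<comment> \<open>\<open>K\<close> bounds the number of steps outside the stretch near the cycle;
    parameters close enough to \<open>a\<close> force \<open>n\<close> to exceed it.\<close>
  define K where "K = N + k1 + k2"
  define F where "F m b = (quad b ^^ (q * m + N)) 0" for m b
  have contF: "continuous_on S (F m)" for m S unfolding F_def by (intro continuous_intros)
  have Fa: "F m a = x" for m
    using quad_pow_mult_fixed[OF x(2)] by (simp only: F_def quad_pow_add x(1)[symmetric])
  have "(F m \<longlongrightarrow> F m a) (nhds a)" for m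
    unfolding F_def by (intro tendsto_intros filterlim_ident)
  then have "((\<lambda>b. \<bar>F m b - x\<bar>) \<longlongrightarrow> \<bar>F m a - x\<bar>) (nhds a)" for m
    by (intro tendsto_intros)
  then have "\<forall>\<^sub>F b in nhds a. \<forall>m\<in>{..K}. \<bar>F m b - x\<bar> < \<delta>"
    using \<delta>(1) by (intro eventually_ball_finite ballI order_tendstoD(2)) (auto simp: Fa)
  then obtain \<eta>3 where \<eta>3: "0 < \<eta>3" "\<And>b m. \<bar>b - a\<bar> < \<eta>3 \<Longrightarrow> m \<le> K \<Longrightarrow> \<bar>F m b - x\<bar> < \<delta>"
    unfolding eventually_nhds_metric dist_real_def by (auto simp: Ball_def)
  define \<rho> where "\<rho> = Min {\<eta>, \<eta>1, \<eta>2, \<eta>3, \<epsilon>, a}"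
  have \<rho>: "0 < \<rho>" "\<rho> \<le> \<eta>" "\<rho> \<le> \<eta>1" "\<rho> \<le> \<eta>2" "\<rho> \<le> \<eta>3" "\<rho> \<le> \<epsilon>" "\<rho> \<le> a"
    using \<eta>(1) \<eta>1 \<eta>2 \<eta>3(1) \<epsilon> a(1) by (auto simp: \<rho>_def)
  \<comment> \<open>Only finitely many parameters satisfy the critical relation, so some
    \<open>c\<close> just below \<open>a\<close> violates it, and its orbit must leave.\<close>
  have "infinite ({a - \<rho><..<a} - {b. (quad b ^^ (q + N)) 0 = (quad b ^^ N) 0})"
    using finite_critical_relation[OF q, of N] \<rho>(1) by (intro Diff_infinite_finite) auto
  then obtain c where "c \<in> {a - \<rho><..<a} - {b. (quad b ^^ (q + N)) 0 = (quad b ^^ N) 0}"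
    using infinite_imp_nonempty by blast
  then have c: "a - \<rho> < c" "c < a" "(quad c ^^ (q + N)) 0 \<noteq> (quad c ^^ N) 0"
    by simp_all
  have near: "\<bar>b - a\<bar> < \<rho>" if "b \<in> {c..a}" for b using that c by auto
  \<comment> \<open>\<open>n\<close> is the first exit over the whole parameter interval
    \<open>{c..a}\<close>. Hence every parameter in it is near \<open>x\<close> at all earlier
    visits, including the one found later by the intermediate value theorem.\<close>
  define exits where "exits n \<longleftrightarrow> (\<exists>b\<in>{c..a}. \<delta> \<le> \<bar>F n b - x\<bar>)" for n
  define n where "n = (LEAST n. exits n)"
  have "\<bar>c - a\<bar> < \<eta>" using near[of c] c \<rho>(2) by simp
  have "(quad c ^^ q) ((quad c ^^ N) 0) \<noteq> (quad c ^^ N) 0" using c(3) by (simp add: quad_pow_add)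
  then obtain n0 where "\<delta> \<le> \<bar>(quad c ^^ (q * n0)) ((quad c ^^ N) 0) - x\<bar>"
    using expanding_exit[OF lam(1) E[OF \<open>\<bar>c - a\<bar> < \<eta>\<close>]] by blast
  then have "exits n0" using c by (auto simp: exits_def F_def quad_pow_add intro!: bexI[of _ c])
  then have "exits n" unfolding n_def by (rule LeastI)
  then obtain d where d: "d \<in> {c..a}" "\<delta> \<le> \<bar>F n d - x\<bar>" by (auto simp: exits_def)
  have stay: "\<bar>F m b - x\<bar> < \<delta>" if "m < n" "b \<in> {c..a}" for m b
    using not_less_Least[of m exits, folded n_def] that by (force simp: exits_def)
  have "K < n"
  proof (rule ccontr)
    assume "\<not> K < n"
    then have "\<bar>F n d - x\<bar> < \<delta>" using near[OF d(1)] \<rho>(5) by (intro \<eta>3(2)) auto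
    then show False using d(2) by simp
  qed
  have xI: "x \<in> ivl_I" using quad_pow_in_ivl[OF a, of 0 N] by (simp add: x(1))
  have dI: "F n d \<in> ivl_I"
    unfolding F_def using d c a \<rho>(7) by (intro quad_pow_in_ivl) auto
  \<comment> \<open>Between \<open>d\<close> and \<open>a\<close> the values of \<open>F n\<close>
    range from distance at least \<open>\<delta>\<close> down to \<open>x\<close> itself. So both
    prepared points on side \<open>\<sigma>\<close> are met; the \<open>k\<close>-th iterate has
    opposite signs at the two parameters, and some parameter gives 0.\<close>
  have reach: "\<exists>b\<in>{d..a}. (quad b ^^ (k + (q * n + N))) 0 = 0"
    if \<sigma>: "\<bar>\<sigma>\<bar> = 1" "\<delta> \<le> \<sigma> * (F n d - x)"
      and sc: "x + \<sigma> * \<delta> \<in> ivl_I \<Longrightarrow> s \<in> {0<..<\<delta>} \<and> t \<in> {0<..<\<delta>} \<and>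
        (\<forall>b. \<bar>b - a\<bar> < \<rho> \<longrightarrow> (quad b ^^ k) (x + \<sigma> * s) < 0 \<and> 0 < (quad b ^^ k) (x + \<sigma> * t))"
    for \<sigma> k s t
  proof -
    have "x + \<sigma> * \<delta> \<in> ivl_I"
      using \<sigma> xI dI \<delta>(1) by (auto simp: abs_if split: if_splits)
    note sc = sc[OF this]
    have hit: "\<exists>b\<in>{d..a}. F n b = x + \<sigma> * u" if "u \<in> {0<..<\<delta>}" for u
    proof -
      have "continuous_on {d..a} (\<lambda>b. \<sigma> * (F n b - x))" by (intro continuous_intros contF)
      moreover have "\<sigma> * (F n a - x) \<le> u" "u \<le> \<sigma> * (F n d - x)"
        using that \<sigma>(2) by (simp_all add: Fa)
      ultimately obtain b where b: "b \<in> {d..a}" "\<sigma> * (F n b - x) = u"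
        using IVT_between[of d a "\<lambda>b. \<sigma> * (F n b - x)" a d u] d(1) by auto
      then show ?thesis using \<sigma>(1) by (intro bexI[of _ b]) (auto simp: abs_if split: if_splits)
    qed
    obtain bs where bs: "bs \<in> {d..a}" "F n bs = x + \<sigma> * s" using sc hit by blast
    obtain bt where bt: "bt \<in> {d..a}" "F n bt = x + \<sigma> * t" using sc hit by blast
    have "\<bar>bs - a\<bar> < \<rho>" "\<bar>bt - a\<bar> < \<rho>" 
      using near[of bs] near[of bt] bs(1) bt(1) d(1) by auto
    then have "(quad bs ^^ k) (F n bs) \<le> 0" "0 \<le> (quad bt ^^ k) (F n bt)"
      unfolding bs(2) bt(2) using sc by (blast intro: less_imp_le)+
    moreover have "continuous_on {d..a} (\<lambda>b. (quad b ^^ k) (F n b))"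
      by (intro continuous_intros contF)
    ultimately obtain b where "b \<in> {d..a}" "(quad b ^^ k) (F n b) = 0"
      using IVT_between[of d a "\<lambda>b. (quad b ^^ k) (F n b)" bs bt 0] bs(1) bt(1) by blast
    then show ?thesis by (intro bexI[of _ b]) (auto simp: F_def quad_pow_add)
  qed
  have "\<exists>k\<le>k1 + k2. \<exists>b\<in>{d..a}. (quad b ^^ (k + (q * n + N))) 0 = 0"
  proof (cases "x \<le> F n d")
    case True
    then have "\<delta> \<le> 1 * (F n d - x)" using d(2) by simp
    then have "\<exists>b\<in>{d..a}. (quad b ^^ (k1 + (q * n + N))) 0 = 0"
      using c1 order_less_le_trans[OF _ \<rho>(3)] by (intro reach[of 1 s1 t1]) (simp, assumption, blast)
    then show ?thesis by (intro exI[of _ k1]) auto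
  next
    case False
    then have "\<delta> \<le> (- 1) * (F n d - x)" using d(2) by simp
    then have "\<exists>b\<in>{d..a}. (quad b ^^ (k2 + (q * n + N))) 0 = 0"
      using c2 order_less_le_trans[OF _ \<rho>(4)]
      by (intro reach[of "- 1" s2 t2]) (simp, assumption, blast)
    then show ?thesis by (intro exI[of _ k2]) auto
  qed
  then obtain k b where k: "k \<le> k1 + k2" and b: "b \<in> {d..a}"
    and 0: "(quad b ^^ (k + (q * n + N))) 0 = 0" by blast
  have bc: "b \<in> {c..a}" using b d(1) by auto
  define L where "L = k + (q * n + N)"
  have "b \<noteq> a"
  proof
    assume "b = a"
    then have "(quad a ^^ k) x = 0"
      using 0 quad_pow_mult_fixed[OF x(2)] by (simp only: quad_pow_add x(1)[symmetric])
    then show False using quad_pow_nonzero[OF x(2) q] D by simp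
  qed
  have "n \<le> q * n" using q by simp
  then have "K < q * n" using \<open>K < n\<close> by linarith
  \<comment> \<open>Here \<open>k + N \<le> K < q * n\<close>, so the stretch near the cycle makes
    up at least half of \<open>L\<close>.\<close>
  then have L: "L \<le> 2 * (q * n)" "0 < L" using k unfolding L_def K_def by linarith+
  have "real L \<le> real (2 * (q * n))" using L(1) by (simp only: of_nat_le_iff)
  then have "real L / 4 \<le> (\<Sum>i\<in>{N..<N + q * n}. 1 / 2)" by simp
  also have "\<dots> \<le> (\<Sum>i\<in>{N..<N + q * n}. \<phi> ((quad b ^^ i) 0))"
  proof (rule sum_mono)
    fix i assume i: "i \<in> {N..<N + q * n}"
    define m where "m = (i - N) div q"
    have "m < n" using i by (auto simp: m_def less_mult_imp_div_less mult.commute)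
    have "i = (i - N) mod q + (q * m + N)" using i by (simp add: m_def)
    then have "(quad b ^^ i) 0 = (quad b ^^ ((i - N) mod q)) (F m b)"
      unfolding F_def quad_pow_add[symmetric] by simp
    moreover have "\<bar>b - a\<bar> < \<eta>" using near[OF bc] \<rho>(2) by simp
    ultimately show "1 / 2 \<le> \<phi> ((quad b ^^ i) 0)"
      using \<phi>'[OF _ stay[OF \<open>m < n\<close> bc], where b = b and j = "(i - N) mod q"] q by simp
  qed
  also have "\<dots> \<le> (\<Sum>i<L. \<phi> ((quad b ^^ i) 0))"
    by (rule sum_mono2) (auto simp: L_def \<phi>(2))
  finally have avg: "real L / 4 \<le> (\<Sum>i<L. \<phi> ((quad b ^^ i) 0))" .
  have "0 < b" "b < a" "a - \<epsilon> < b" using bc c \<rho> \<open>b \<noteq> a\<close> by auto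
  then show thesis using L(2) 0[folded L_def] avg by (rule that)
qed

subsection \<open>Natural measures\<close>

lemma sum_periodic:
  fixes h :: "nat \<Rightarrow> real"
  assumes "\<And>i. h (i + r) = h i"
  shows "(\<Sum>i<r * n. h i) = real n * (\<Sum>i<r. h i)"
proof -
  have shift: "h (i + m * r) = h i" for i m
  proof (induction m)
    case (Suc m)
    then show ?case using assms[of "i + m * r"] by (simp add: algebra_simps)
  qed simp
  have "(\<Sum>i = m * r..<m * r + r. h i) = (\<Sum>i<r. h i)" for m
    using sum.shift_bounds_nat_ivl[of h 0 "m * r" r]
    by (simp add: shift lessThan_atLeast0 add.commute[of r])
  then show ?thesis using sum.nat_group[of h r n] by (simp add: mult.commute[of n])
qed

section \<open>Periodic orbits and averages along the critical orbit\<close>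

lemma periodic_orbit_props:
  assumes "periodic_point a p x"
  shows "finite (periodic_orbit a p x)" "periodic_orbit a p x \<noteq> {}"
    "card (periodic_orbit a p x) = p"
proof -
  have p: "0 < p" "(quad a ^^ p) x = x" "\<And>k. 0 < k \<Longrightarrow> k < p \<Longrightarrow> (quad a ^^ k) x \<noteq> x"
    using assms by (auto simp: periodic_point_def)
  have "(quad a ^^ k) x \<noteq> (quad a ^^ l) x" if "k < l" "l < p" for k l
  proof
    assume eq: "(quad a ^^ k) x = (quad a ^^ l) x"
    have "(quad a ^^ (p - l + k)) x = (quad a ^^ (p - l + l)) x"
      by (simp only: quad_pow_add eq)
    then have "(quad a ^^ (p - l + k)) x = x" using that p(2) by simp
    then show False using p(3)[of "p - l + k"] that by linarith
  qed
  then have "inj_on (\<lambda>k. (quad a ^^ k) x) {..<p}"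
    by (auto intro: linorder_inj_onI)
  then show "card (periodic_orbit a p x) = p" by (simp add: periodic_orbit_def card_image)
  show "finite (periodic_orbit a p x)" "periodic_orbit a p x \<noteq> {}"
    using p(1) by (auto simp: periodic_orbit_def)
qed

lemma periodic_orbit_subset_ivl:
  assumes "0 < a" "a \<le> 2" "periodic_point a p x"
  shows "periodic_orbit a p x \<subseteq> ivl_I"
  using assms quad_pow_in_ivl[OF assms(1,2), of x] by (auto simp: periodic_orbit_def periodic_point_def)

lemma integral_orbit_measure:
  fixes \<phi> :: "real \<Rightarrow> real"
  assumes "finite C" "C \<noteq> {}" "C \<subseteq> ivl_I" "\<phi> \<in> borel_measurable borel"
  shows "(\<integral>x. \<phi> x \<partial>orbit_measure C) = (\<Sum>x\<in>C. \<phi> x) / card C"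
proof -
  have "(\<lambda>x. x) \<in> measurable (uniform_count_measure C) (restrict_space borel ivl_I)"
    using assms(3) by (auto simp: measurable_def space_uniform_count_measure
      sets_uniform_count_measure space_restrict_space)
  moreover have "\<phi> \<in> borel_measurable (restrict_space borel ivl_I)"
    using assms(4) by (rule measurable_restrict_space1)
  ultimately have "(\<integral>x. \<phi> x \<partial>orbit_measure C) = (\<integral>x. \<phi> x \<partial>uniform_count_measure C)"
    unfolding orbit_measure_def by (rule integral_distr)
  also have "\<dots> = (\<Sum>x\<in>C. \<phi> x) / card C"
    using assms(1) by (rule integral_uniform_count_measure)
  finally show ?thesis .
qed

text \<open>By Singer's theorem any attractor is the cycle of the periodic critical point.
  \<open>C\<close> is arbitrary because \<open>natural_measure\<close> picks an attractor by choice,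
  and \<open>L\<close> may be any multiple of the minimal period.\<close>

lemma orbit_measure_average:
  fixes \<phi> :: "real \<Rightarrow> real"
  assumes a: "0 < a" "a \<le> 2" and C: "periodic_attractor a C"
    and L: "0 < L" "(quad a ^^ L) 0 = 0" and \<phi>: "\<phi> \<in> borel_measurable borel"
  shows "(\<integral>x. \<phi> x \<partial>orbit_measure C) = (\<Sum>i<L. \<phi> ((quad a ^^ i) 0)) / L"
proof -
  obtain r y where per: "periodic_point a r y" and Cdef: "C = periodic_orbit a r y"
    and D: "\<bar>quad_secant a r y y\<bar> < 1"
    using C by (auto simp: periodic_attractor_def deriv_quad_pow)
  have r: "0 < r" "(quad a ^^ r) y = y" using per by (auto simp: periodic_point_def)
  \<comment> \<open>Two turns make the multiplier a square, hence nonnegative as Singer's theorem is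
    stated here.\<close>
  have D2: "quad_secant a (r * 2) y y = (quad_secant a r y y)\<^sup>2"
    using r(2) by (rule quad_secant_mult_fixed)
  moreover have "(quad_secant a r y y)\<^sup>2 < 1" using D by (simp add: abs_square_less_1)
  ultimately obtain j where j: "(\<lambda>n. (quad a ^^ (j + r * 2 * n)) 0) \<longlonglongrightarrow> y"
    using attracting_fixed_point_attracts_zero[OF a(1) _ quad_pow_mult_fixed[OF r(2), of 2]] r(1)
    by (metis mult_pos_pos pos2 zero_le_power2)
  \<comment> \<open>Sampled at multiples of \<open>L\<close> the convergent sequence is constant, so
    its limit \<open>y\<close> lies on the critical orbit itself.\<close>
  have "(quad a ^^ (j + r * 2 * (L * m))) 0 = (quad a ^^ j) 0" for m
  proof -
    have "j + r * 2 * (L * m) = j + L * (r * 2 * m)" by simp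
    then show ?thesis using quad_pow_mult_fixed[OF L(2)] by (simp only: quad_pow_add)
  qed
  moreover have "(\<lambda>m. (quad a ^^ (j + r * 2 * (L * m))) 0) \<longlonglongrightarrow> y"
    using LIMSEQ_subseq_LIMSEQ[OF j, of "\<lambda>m. L * m"] L(1) by (simp add: strict_mono_def o_def)
  ultimately have y: "y = (quad a ^^ j) 0" by (simp add: LIMSEQ_const_iff)
  have "j \<le> L * j" using L(1) by simp
  then have "(quad a ^^ (L * j - j)) y = (quad a ^^ (L * j)) 0"
    by (simp add: y quad_pow_add[symmetric])
  then have y0: "(quad a ^^ (L * j - j)) y = 0" using quad_pow_mult_fixed[OF L(2)] by simp
  have "(quad a ^^ r) ((quad a ^^ (L * j - j)) y) = (quad a ^^ (L * j - j)) ((quad a ^^ r) y)"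
    by (simp only: quad_pow_add[symmetric] add.commute)
  then have r0: "(quad a ^^ r) 0 = 0" by (simp only: r(2) y0)
  define h where "h i = \<phi> ((quad a ^^ i) 0)" for i
  have hr: "h (i + r) = h i" and hL: "h (i + L) = h i" for i
    by (simp_all only: h_def quad_pow_add r0 L(2))
  define C' where "C' = (\<lambda>k. (quad a ^^ k) 0) ` {..<r}"
  have "C \<subseteq> C'"
  proof -
    have "(quad a ^^ k) y \<in> C'" for k
    proof -
      have "(quad a ^^ k) y = (quad a ^^ ((k + j) mod r + r * ((k + j) div r))) 0"
        by (simp add: y quad_pow_add)
      also have "\<dots> = (quad a ^^ ((k + j) mod r)) 0"
        using quad_pow_mult_fixed[OF r0] by (simp only: quad_pow_add)
      finally show ?thesis using r(1) by (simp add: C'_def)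
    qed
    then show ?thesis by (auto simp: Cdef periodic_orbit_def)
  qed
  \<comment> \<open>\<open>C\<close> has exactly \<open>r\<close> points because \<open>r\<close> is
    a minimal period, and \<open>C'\<close> has at most \<open>r\<close>; so the two sets agree and
    the first \<open>r\<close> critical iterates are distinct.\<close>
  moreover have "card C' \<le> card C"
    using periodic_orbit_props(3)[OF per] card_image_le[of "{..<r}" "\<lambda>k. (quad a ^^ k) 0"]
    by (simp add: C'_def Cdef)
  ultimately have CC': "C = C'" by (intro card_seteq) (auto simp: C'_def)
  have card: "card C' = r" using periodic_orbit_props(3)[OF per] by (simp add: Cdef CC'[symmetric])
  then have "inj_on (\<lambda>k. (quad a ^^ k) 0) {..<r}"
    by (intro eq_card_imp_inj_on) (simp_all add: C'_def)
  then have "(\<Sum>x\<in>C. \<phi> x) = (\<Sum>i<r. h i)"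
    unfolding CC' C'_def h_def by (simp add: sum.reindex)
  \<comment> \<open>The sum over the common period \<open>r * L\<close> is evaluated in two
    ways.\<close>
  moreover have "(\<Sum>i<r. h i) / r = (\<Sum>i<L. h i) / L"
    using sum_periodic[of h L, OF hL, of r] sum_periodic[of h r, OF hr, of L] r(1) L(1)
    by (simp add: field_simps mult.commute)
  moreover have "(\<integral>x. \<phi> x \<partial>orbit_measure C) = (\<Sum>x\<in>C. \<phi> x) / card C"
    using periodic_orbit_props[OF per] periodic_orbit_subset_ivl[OF a per] \<phi>
    by (intro integral_orbit_measure) (auto simp: Cdef)
  ultimately show ?thesis
    using card by (simp add: CC' h_def)
qed

lemma periodic_critical_point_attractor:
  assumes "0 < L" "(quad a ^^ L) 0 = 0"
  shows "\<exists>C. periodic_attractor a C"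
proof -
  define r where "r = (LEAST r. 0 < r \<and> (quad a ^^ r) 0 = 0)"
  have r: "0 < r" "(quad a ^^ r) 0 = 0"
    using LeastI[of "\<lambda>r. 0 < r \<and> (quad a ^^ r) 0 = 0" L] assms unfolding r_def by auto
  have "(quad a ^^ k) 0 \<noteq> 0" if "0 < k" "k < r" for k
    using not_less_Least[of k "\<lambda>r. 0 < r \<and> (quad a ^^ r) 0 = 0"] that unfolding r_def by blast
  then have "periodic_point a r 0" using r by (simp add: periodic_point_def)
  moreover have "quad_secant a r 0 0 = 0"
    unfolding quad_secant_def using r(1) by (intro prod_zero) (auto intro!: bexI[of _ 0])
  then have "\<bar>deriv (quad a ^^ r) 0\<bar> < 1" by (simp add: deriv_quad_pow)
  ultimately show ?thesis unfolding periodic_attractor_def by blast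
qed

text \<open>\<open>Q\<close> is a common multiple of both periods. Its factor 2 turns the multiplier
  of the attractor into a power of a square, so that \<open>pcf_no_attracting_fixed_point\<close>
  applies.\<close>

lemma pcf_no_attractor:
  assumes a: "0 < a" and q: "0 < q" and x: "x = (quad a ^^ N) 0" "(quad a ^^ q) x = x"
    and D: "1 < quad_secant a q x x"
  shows "\<not> periodic_attractor a C"
proof
  assume "periodic_attractor a C"
  then obtain r y where "periodic_point a r y" and Dy: "\<bar>quad_secant a r y y\<bar> < 1"
    by (auto simp: periodic_attractor_def deriv_quad_pow)
  then have r: "0 < r" "(quad a ^^ r) y = y" by (auto simp: periodic_point_def)
  define Q where "Q = r * (2 * q)"
  have Q: "0 < Q" "Q = q * (2 * r)" using r(1) q by (auto simp: Q_def)
  have "1 < quad_secant a Q x x"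
    unfolding Q(2) quad_secant_mult_fixed[OF x(2)] using D r(1) by (intro one_less_power) auto
  moreover have "(quad a ^^ Q) x = x"
    unfolding Q(2) using x(2) by (rule quad_pow_mult_fixed)
  moreover have "(quad a ^^ Q) y = y"
    unfolding Q_def using r(2) by (rule quad_pow_mult_fixed)
  moreover have Dyy: "quad_secant a Q y y = ((quad_secant a r y y)\<^sup>2) ^ q"
    unfolding Q_def quad_secant_mult_fixed[OF r(2)] by (rule power_mult)
  ultimately have "1 \<le> ((quad_secant a r y y)\<^sup>2) ^ q"
    using pcf_no_attracting_fixed_point[OF a Q(1) x(1)] by (metis zero_le_power zero_le_power2)
  moreover have "(quad_secant a r y y)\<^sup>2 < 1" using Dy by (simp add: abs_square_less_1)
  then have "((quad_secant a r y y)\<^sup>2) ^ q < 1" using q by (simp add: power_less_one_iff)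
  ultimately show False by simp
qed

section \<open>Test functions and null sets\<close>

text \<open>Tent functions of height 1 over \<open>C\<close> shrink to the indicator of
  \<open>C\<close>, so by dominated convergence their integrals tend to the measure of
  \<open>C\<close>, which is 0.\<close>

lemma finite_measure_test_function:
  assumes fin: "finite_measure \<mu>" and sets: "sets \<mu> = sets (restrict_space borel ivl_I)"
    and C: "finite C" "C \<noteq> {}" "C \<subseteq> ivl_I" "measure \<mu> C = 0"
  obtains \<phi> :: "real \<Rightarrow> real" where "continuous_on UNIV \<phi>" "\<And>y. 0 \<le> \<phi> y"
    "\<And>y. y \<in> C \<Longrightarrow> \<phi> y = 1" "(\<integral>x. \<phi> x \<partial>\<mu>) < 1 / 4"
proof -
  interpret finite_measure \<mu> by (rule fin)
  define \<phi> where "\<phi> m y = max 0 (1 - real m * infdist y C)" for m y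
  have cont: "continuous_on UNIV (\<phi> m)" for m unfolding \<phi>_def by (intro continuous_intros)
  have meas: "f \<in> borel_measurable \<mu>" if "f \<in> borel_measurable borel" for f :: "real \<Rightarrow> real"
    using measurable_restrict_space1[OF that, of ivl_I] measurable_cong_sets[OF sets refl] by blast
  have lim: "(\<lambda>m. \<phi> m y) \<longlonglongrightarrow> indicator C y" for y
  proof (cases "y \<in> C")
    case True
    then show ?thesis by (simp add: \<phi>_def)
  next
    case False
    then have "0 < infdist y C"
      using C finite_imp_closed[OF C(1)] infdist_nonneg[of y C]
      by (metis in_closed_iff_infdist_zero order.order_iff_strict)
    then obtain k where "1 < real k * infdist y C" using reals_Archimedean3 by blast
    moreover have "real k * infdist y C \<le> real m * infdist y C" if "k \<le> m" for m
      using that infdist_nonneg by (intro mult_right_mono) auto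
    ultimately have "\<phi> m y = 0" if "k \<le> m" for m using that by (force simp: \<phi>_def)
    then have "\<forall>\<^sub>F m in sequentially. \<phi> m y = 0" unfolding eventually_sequentially by blast
    then show ?thesis using False by (simp add: tendsto_eventually)
  qed
  have "(\<lambda>m. \<integral>x. \<phi> m x \<partial>\<mu>) \<longlonglongrightarrow> (\<integral>x. indicator C x \<partial>\<mu>)"
  proof (rule integral_dominated_convergence[where w = "\<lambda>_. 1"])
    show "(indicator C :: real \<Rightarrow> real) \<in> borel_measurable \<mu>"
      by (rule meas) (intro borel_measurable_indicator borel_closed finite_imp_closed C(1))
    show "\<phi> m \<in> borel_measurable \<mu>" for m
      using cont by (intro meas borel_measurable_continuous_onI)
    show "AE x in \<mu>. norm (\<phi> m x) \<le> 1" for m by (simp add: \<phi>_def infdist_nonneg)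
  qed (simp_all add: lim)
  moreover have "(\<integral>x. indicator C x \<partial>\<mu>) = (0::real)"
    using C(3,4) sets_eq_imp_space_eq[OF sets] by (simp add: space_restrict_space Int_absorb2)
  ultimately have "\<forall>\<^sub>F m in sequentially. (\<integral>x. \<phi> m x \<partial>\<mu>) < 1 / 4"
    by (intro order_tendstoD(2)[where y = 0]) auto
  then obtain m where "(\<integral>x. \<phi> m x \<partial>\<mu>) < 1 / 4" unfolding eventually_sequentially by blast
  then show thesis using cont by (intro that[of "\<phi> m"]) (auto simp: \<phi>_def)
qed

lemma acip_finite_null:
  assumes "acip a \<mu>" "finite C" "C \<subseteq> ivl_I"
  shows "measure \<mu> C = 0"
proof -
  have "C \<in> sets (restrict_space lborel ivl_I)"
    using assms(2,3) by (auto simp: sets_restrict_space finite_imp_closed intro!: image_eqI[of _ _ C])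
  moreover have "emeasure (restrict_space lborel ivl_I) C = 0"
    using assms(2,3) by (simp add: emeasure_restrict_space emeasure_lborel_countable countable_finite)
  ultimately have "C \<in> null_sets (restrict_space lborel ivl_I)" by (rule null_setsI[rotated])
  then have "C \<in> null_sets \<mu>" using assms(1) by (auto simp: acip_def absolutely_continuous_def)
  then show ?thesis by (simp add: measure_def null_setsD1)
qed

theorem corollary2:
  fixes a :: real
  assumes "0 < a" and "a \<le> 2"
    and "pcf_misiurewicz a"
  shows "\<not> limitin weak_star natural_measure (natural_measure a) (at a within natural_params)"
proof
  assume lim: "limitin weak_star natural_measure (natural_measure a) (at a within natural_params)"
  obtain N p y k where per: "periodic_point a p y" and Dp: "1 < \<bar>quad_secant a p y y\<bar>"
    and k: "(quad a ^^ N) 0 = (quad a ^^ k) y"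
    using assms(3)
    by (auto simp: pcf_misiurewicz_def unstable_periodic_orbit_def deriv_quad_pow periodic_orbit_def)
  define x where "x = (quad a ^^ N) 0"
  define C where "C = periodic_orbit a p y"
  \<comment> \<open>Doubling the period replaces the multiplier of the cycle, possibly negative, by
    its square.\<close>
  define q where "q = p * 2"
  have p: "0 < p" "(quad a ^^ p) y = y" using per by (auto simp: periodic_point_def)
  have q: "0 < q" using p by (simp add: q_def)
  have xp: "(quad a ^^ p) x = x"
    unfolding x_def k quad_pow_add[symmetric] add.commute[of p k]
    by (simp only: quad_pow_add p)
  have xq: "(quad a ^^ q) x = x" unfolding q_def using xp by (rule quad_pow_mult_fixed)
  have "quad_secant a p x x = quad_secant a p y y"
    unfolding x_def k using p Dp by (intro quad_secant_orbit) auto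
  then have "quad_secant a q x x = \<bar>quad_secant a p y y\<bar>\<^sup>2"
    unfolding q_def quad_secant_mult_fixed[OF xp] by simp
  then have D: "1 < quad_secant a q x x" using Dp one_less_power[of "\<bar>quad_secant a p y y\<bar>" 2] by simp
  have xC: "(quad a ^^ j) x \<in> C" for j
  proof -
    have "(quad a ^^ j) x = (quad a ^^ ((j + k) mod p + p * ((j + k) div p))) y"
      by (simp add: x_def k quad_pow_add)
    also have "\<dots> = (quad a ^^ ((j + k) mod p)) y"
      using quad_pow_mult_fixed[OF p(2)] by (simp only: quad_pow_add)
    finally show ?thesis using p(1) by (simp add: C_def periodic_orbit_def)
  qed
  have C: "finite C" "C \<noteq> {}" "C \<subseteq> ivl_I"
    using periodic_orbit_props[OF per] periodic_orbit_subset_ivl[OF assms(1,2) per] by (auto simp: C_def)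
  let ?\<mu> = "natural_measure a"
  have "\<not> periodic_attractor a B" for B
    using pcf_no_attractor[OF assms(1) q x_def xq D] .
  \<comment> \<open>Without an attractor only the last two branches of
    \<open>natural_measure\<close> remain, and \<open>C\<close> has measure 0 in both.\<close>
  then have cases: "acip a ?\<mu> \<or> ?\<mu> = null_measure (restrict_space borel ivl_I)"
    unfolding natural_measure_def by (auto intro: someI)
  then have \<mu>: "finite_measure ?\<mu>" "sets ?\<mu> = sets (restrict_space borel ivl_I)" "measure ?\<mu> C = 0"
    using acip_finite_null[OF _ C(1,3), of a ?\<mu>]
    by (auto simp: acip_def prob_space_def intro: finite_measureI)
  obtain \<phi> :: "real \<Rightarrow> real" where \<phi>: "continuous_on UNIV \<phi>" "\<And>y. 0 \<le> \<phi> y"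
    "\<And>y. y \<in> C \<Longrightarrow> \<phi> y = 1" "(\<integral>x. \<phi> x \<partial>?\<mu>) < 1 / 4"
    using finite_measure_test_function[OF \<mu>(1,2) C \<mu>(3)] by blast
  \<comment> \<open>A subbasic neighbourhood of the natural measure of \<open>quad a\<close>. The
    superstable parameter \<open>b\<close> supplied below has integral at least
    \<open>1 / 4\<close>, so its natural measure lies outside.\<close>
  define U where "U = {\<nu>. sets \<nu> = sets (restrict_space borel ivl_I) \<and> finite_measure \<nu> \<and>
    (\<integral>x. \<phi> x \<partial>\<nu>) \<in> {..<1 / 4}}"
  have "openin weak_star U"
    unfolding weak_star_def U_def using continuous_on_subset[OF \<phi>(1), of ivl_I]
    by (intro topology_generated_by_Basis CollectI exI[of _ \<phi>] exI[of _ "{..<1 / 4}"]) simp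
  moreover have "?\<mu> \<in> U" using \<mu> \<phi>(4) by (simp add: U_def)
  ultimately have "\<forall>\<^sub>F b in at a within natural_params. natural_measure b \<in> U"
    using lim by (simp add: limitin_def)
  then obtain \<epsilon> where \<epsilon>: "0 < \<epsilon>"
    "\<And>b. b \<in> natural_params \<Longrightarrow> b \<noteq> a \<Longrightarrow> \<bar>b - a\<bar> < \<epsilon> \<Longrightarrow> natural_measure b \<in> U"
    unfolding eventually_at dist_real_def by blast
  have "1 / 2 < \<phi> ((quad a ^^ j) x)" for j using \<phi>(3)[OF xC] by simp
  then obtain b L where b: "0 < b" "b < a" "a - \<epsilon> < b" and L: "0 < L" "(quad b ^^ L) 0 = 0"
    and avg: "real L / 4 \<le> (\<Sum>i<L. \<phi> ((quad b ^^ i) 0))"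
    using superstable_perturbation[OF assms(1,2) q x_def xq D \<phi>(1,2) _ \<epsilon>(1)] by metis
  have ex: "\<exists>B. periodic_attractor b B" using L by (rule periodic_critical_point_attractor)
  then have "b \<in> natural_params" using b assms(2) by (auto simp: natural_params_def)
  then have "(\<integral>x. \<phi> x \<partial>natural_measure b) < 1 / 4"
    using \<epsilon>(2)[of b] b by (auto simp: U_def)
  moreover have "natural_measure b = orbit_measure (SOME B. periodic_attractor b B)"
    using ex by (simp add: natural_measure_def)
  moreover have "periodic_attractor b (SOME B. periodic_attractor b B)" using ex by (rule someI_ex)
  ultimately have "(\<Sum>i<L. \<phi> ((quad b ^^ i) 0)) / L < 1 / 4"
    using orbit_measure_average[OF b(1) _ _ L, of _ \<phi>] b(2) assms(2)
      borel_measurable_continuous_onI[OF \<phi>(1)] by simp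
  then show False using avg L(1) by (simp add: field_simps)
qed

end
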